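(* Let $m\le d$ be positive integers, $n=m+d$, $\mathcal U=[0,1]^d$, and let $\mathbf f=(f_1,\dots,f_m):\mathcal U\to\mathbb R^m$ be such that all partial derivatives $\partial \mathbf f/\partial\alpha_i$ and $\partial^2\mathbf f/\partial\alpha_i\partial\alpha_j$ exist and are continuous on $\mathcal U$. Let $\boldsymbol\theta\in\mathbb R^n$ and let $\psi:[0,\infty)\to[0,\infty)$ be a function with $\psi(r)\to0$ as $r\to\infty$ and $$\psi(q)\ge q^{-1/(2m+1)}(\log q)^{2/(2m+1)}\quad\text{for all } q\in\mathcal N:=\{q\in\mathbb N:\psi(q)>0\}.$$ Let $0<s\le d$ and suppose $$\mathcal H^s\left(\left\{\boldsymbol\alpha\in\mathcal U:\ \det\left(\frac{\partial^2 f_j}{\partial\alpha_1\partial\alpha_i}(\boldsymbol\alpha)\right)_{1\le i,j\le m}=0\right\}\right)=0.$$ Then $$\mathcal H^s\big(\mathcal M_{\mathbf f}\cap\mathcal S_n(\psi,\boldsymbol\theta)\big)=0\quad\text{whenever}\quad\sum_{q=1}^\infty\left(\frac{\psi(q)}{q}\right)^{s+m}q^n<\infty.$$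
   Context: $\mathcal H^s$ denotes $s$-dimensional Hausdorff measure. $\mathcal M_{\mathbf f}=\{(\boldsymbol\alpha,\mathbf f(\boldsymbol\alpha))\in\mathbb R^n:\boldsymbol\alpha\in\mathcal U\}$. For $x\in\mathbb R$, $\|x\|$ is the distance to the nearest integer, and for $\mathbf x\in\mathbb R^n$, $\|\mathbf x\|=\max_i\|x_i\|$. $\mathcal S_n(\psi,\boldsymbol\theta)$ is the set of $\mathbf y\in\mathbb R^n$ such that $\|q\mathbf y-\boldsymbol\theta\|<\psi(q)$ for infinitely many $q\in\mathbb N$. *)

theory Defs
  imports "HOL-Analysis.Analysis"
begin

text \<open>
  Hausdorff measure. The covering sets are required to be bounded because
  \<^const>\<open>diameter\<close> is a real number and carries no information about unbounded sets.
  Empty covering sets contribute \<open>0 powr s = 0\<close>, so finite covers are included. The definition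
  is meant for \<open>s > 0\<close>; for \<open>s = 0\<close> the convention \<open>0 powr 0 = 0\<close> does not give counting measure.
\<close>

definition hausdorff_premeasure :: "real \<Rightarrow> real \<Rightarrow> 'a::metric_space set \<Rightarrow> ennreal" where
  "hausdorff_premeasure \<delta> s A =
     (INF C \<in> {C :: nat \<Rightarrow> 'a set. A \<subseteq> (\<Union>i. C i) \<and> (\<forall>i. bounded (C i) \<and> diameter (C i) \<le> \<delta>)}.
        \<Sum>i. ennreal (diameter (C i) powr s))"

definition hausdorff_measure :: "real \<Rightarrow> 'a::metric_space set \<Rightarrow> ennreal" where
  "hausdorff_measure s A = (SUP \<delta> \<in> {0<..}. hausdorff_premeasure \<delta> s A)"


definition dist_to_int :: "real \<Rightarrow> real" where
  "dist_to_int x = \<bar>x - of_int (round x)\<bar>"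

definition dist_to_int_vec :: "'a::euclidean_space \<Rightarrow> real" where
  "dist_to_int_vec x = Max ((\<lambda>b. dist_to_int (x \<bullet> b)) ` Basis)"

definition approximable :: "(real \<Rightarrow> real) \<Rightarrow> 'a::euclidean_space \<Rightarrow> 'a set" where
  "approximable \<psi> \<theta> =
     {y. infinite {q::nat. q \<ge> 1 \<and> dist_to_int_vec (real q *\<^sub>R y - \<theta>) < \<psi> (real q)}}"


text \<open>
  Partial derivatives relative to a set \<open>S\<close>: the increment in the \<open>i\<close>-th coordinate is restricted
  to points of \<open>S\<close>, so on the faces of a closed box the derivatives are one-sided, and values
  of \<open>f\<close> outside \<open>S\<close> are irrelevant.
\<close>

definition partial_differentiable ::
    "(real ^ 'd) set \<Rightarrow> 'd \<Rightarrow> (real ^ 'd \<Rightarrow> 'b::real_normed_vector) \<Rightarrow> real ^ 'd \<Rightarrow> bool" where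
  "partial_differentiable S i f x \<longleftrightarrow>
     (\<lambda>t. f (x + t *\<^sub>R axis i 1)) differentiable (at 0 within {t. x + t *\<^sub>R axis i 1 \<in> S})"

definition partial_derivative ::
    "(real ^ 'd) set \<Rightarrow> 'd \<Rightarrow> (real ^ 'd \<Rightarrow> 'b::real_normed_vector) \<Rightarrow> real ^ 'd \<Rightarrow> 'b" where
  "partial_derivative S i f x =
     vector_derivative (\<lambda>t. f (x + t *\<^sub>R axis i 1)) (at 0 within {t. x + t *\<^sub>R axis i 1 \<in> S})"

definition C2_partials_on ::
    "(real ^ 'd) set \<Rightarrow> (real ^ 'd \<Rightarrow> 'b::real_normed_vector) \<Rightarrow> bool" where
  "C2_partials_on S f \<longleftrightarrow>
     (\<forall>i. (\<forall>x\<in>S. partial_differentiable S i f x) \<and> continuous_on S (partial_derivative S i f)) \<and>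
     (\<forall>i j. (\<forall>x\<in>S. partial_differentiable S i (partial_derivative S j f) x) \<and>
            continuous_on S (partial_derivative S i (partial_derivative S j f)))"


text \<open>
  The linear order of an index type numbers its elements \<open>1, \<dots>, CARD('d)\<close>: \<open>nth_index k\<close> is the
  \<open>k\<close>-th element and \<open>index_pos\<close> is the inverse numbering.
\<close>

definition nth_index :: "nat \<Rightarrow> 'd::{finite,linorder}" where
  "nth_index k = sorted_list_of_set UNIV ! (k - 1)"

definition index_pos :: "'m::{finite,linorder} \<Rightarrow> nat" where
  "index_pos i = card {..i}"

definition mixed_hessian ::
    "(real ^ 'd::{finite,linorder}) set \<Rightarrow>
     (real ^ 'd::{finite,linorder} \<Rightarrow> real ^ 'm::{finite,linorder}) \<Rightarrow>
     real ^ 'd::{finite,linorder} \<Rightarrow> real ^ 'm::{finite,linorder} ^ 'm::{finite,linorder}" where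
  "mixed_hessian S f x =
     (\<chi> i j. partial_derivative S (nth_index 1)
               (partial_derivative S (nth_index (index_pos i)) (\<lambda>y. f y $ j)) x)"


text \<open>The ambient space of dimension \<open>d + m\<close> is the Euclidean product space.\<close>

definition graph_manifold ::
    "(real ^ 'd) set \<Rightarrow> (real ^ 'd \<Rightarrow> real ^ 'm) \<Rightarrow> ((real ^ 'd) \<times> (real ^ 'm)) set" where
  "graph_manifold S f = {(x, f x) | x. x \<in> S}"

abbreviation unit_cube :: "(real ^ 'd) set" where
  "unit_cube \<equiv> cbox 0 1"

end

theory Submission
  imports Defs
begin

text \<open>
  The theorem follows from a covering argument once the shifted rational points \<open>z\<close> of denominator
  \<open>q\<close> near which \<open>q f(z)\<close> is within \<open>\<delta> \<asymp> \<psi>(q)\<close> of \<open>\<gamma> + \<int>\<^sup>m\<close> are bounded in number by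
  \<open>C \<delta>\<^sup>m q\<^sup>d\<close>, locally around a point where the mixed Hessian is invertible. This count needs no
  exponential sums. Cut the grid into windows of length \<open>\<rho> = \<lfloor>\<surd>(q \<delta>)\<rfloor>\<close> in the direction of
  \<open>\<alpha>\<^sub>1\<close>. On a window \<open>q f\<close> is affine with slope \<open>w = \<partial>\<^sub>1 f\<close> up to \<open>O(\<delta>)\<close>, so subtracting the first
  solution \<open>p\<close> in the window shows that any further solution, \<open>x\<close> steps away, forces \<open>x w(p)\<close>
  to be within \<open>O(\<delta>)\<close> of an integer vector. There are \<open>O(q\<^sup>d / \<rho>)\<close> windows, which is
  \<open>O(\<delta>\<^sup>m q\<^sup>d)\<close> because \<open>\<delta>\<close> to the power \<open>2 m + 1\<close> is at least \<open>1 / q\<close>. For fixed \<open>x\<close> there are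
  \<open>O(x\<^sup>m)\<close> candidate integer vectors, and since \<open>w\<close> separates points in the first \<open>m\<close> coordinates,
  each candidate confines these coordinates of \<open>p\<close> to a cube of side \<open>O(\<delta> / x)\<close>; hence a proportion
  \<open>O(\<delta>\<^sup>m)\<close> of the windows survives, and summing over \<open>x < \<rho>\<close> costs exactly the factor \<open>\<rho>\<close>
  gained from counting windows.
\<close>

subsection \<open>Hausdorff null sets\<close>

lemma diameter_leI:
  fixes S :: "'a::metric_space set"
  assumes "\<And>x y. x \<in> S \<Longrightarrow> y \<in> S \<Longrightarrow> dist x y \<le> r" "0 \<le> r"
  shows "diameter S \<le> r"
  unfolding diameter_def using assms by (auto intro!: cSUP_least)

lemma hausdorff_premeasure_le_suminf:
  fixes C :: "nat \<Rightarrow> 'a::metric_space set"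
  assumes "A \<subseteq> (\<Union>i. C i)" "\<And>i. bounded (C i)" "\<And>i. diameter (C i) \<le> \<delta>"
  shows "hausdorff_premeasure \<delta> s A \<le> (\<Sum>i. ennreal (diameter (C i) powr s))"
  unfolding hausdorff_premeasure_def using assms by (intro INF_lower) auto

lemma hausdorff_premeasure_lessE:
  fixes A :: "'a::metric_space set"
  assumes "hausdorff_premeasure \<delta> s A < x"
  obtains C :: "nat \<Rightarrow> 'a set" where "A \<subseteq> (\<Union>i. C i)" "\<And>i. bounded (C i)" "\<And>i. diameter (C i) \<le> \<delta>"
    "(\<Sum>i. ennreal (diameter (C i) powr s)) < x"
  using assms unfolding hausdorff_premeasure_def INF_less_iff by blast

lemma hausdorff_premeasure_mono:
  "A \<subseteq> B \<Longrightarrow> hausdorff_premeasure \<delta> s A \<le> hausdorff_premeasure \<delta> s B"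
  unfolding hausdorff_premeasure_def by (intro INF_superset_mono) auto

lemma hausdorff_measure_mono:
  "A \<subseteq> B \<Longrightarrow> hausdorff_measure s A \<le> hausdorff_measure s B"
  unfolding hausdorff_measure_def by (intro SUP_mono') (auto intro: hausdorff_premeasure_mono)

lemma hausdorff_measure_eq_0_iff:
  "hausdorff_measure s A = 0 \<longleftrightarrow> (\<forall>\<delta>>0. hausdorff_premeasure \<delta> s A = 0)"
  unfolding hausdorff_measure_def by (auto simp: SUP_eq_iff[of _ 0] bot_ennreal[symmetric] SUP_bot_conv)

text \<open>Covers of the \<open>A n\<close> that are optimal up to \<epsilon> / 2^(n+1) are merged
  into one sequence by the bijection between naturals and pairs.\<close>

lemma hausdorff_premeasure_countable_subadditive:
  fixes A :: "nat \<Rightarrow> 'a::metric_space set"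
  shows "hausdorff_premeasure \<delta> s (\<Union>n. A n) \<le> (\<Sum>n. hausdorff_premeasure \<delta> s (A n))"
proof (rule ennreal_le_epsilon)
  fix \<epsilon> :: real assume fin: "(\<Sum>n. hausdorff_premeasure \<delta> s (A n)) < top" and \<epsilon>: "0 < \<epsilon>"
  define h where "h n = ennreal (\<epsilon> * (1/2) ^ Suc n)" for n
  have h: "(\<Sum>n. h n) = ennreal \<epsilon>"
  proof -
    have "(\<lambda>n. \<epsilon> * (1/2) ^ Suc n) sums (\<epsilon> * 1)" by (intro sums_mult power_half_series)
    then show ?thesis unfolding h_def using \<epsilon> by (intro sums_unique[symmetric]) simp
  qed
  have "\<exists>C. A n \<subseteq> (\<Union>i. C i) \<and> (\<forall>i. bounded (C i) \<and> diameter (C i) \<le> \<delta>) \<and>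
          (\<Sum>i. ennreal (diameter (C i) powr s)) \<le> hausdorff_premeasure \<delta> s (A n) + h n" for n
  proof -
    \<comment> \<open>Finiteness of the total makes each term finite, so adding \<open>h n\<close>
      strictly increases it and a cover below the increased value exists.\<close>
    have "hausdorff_premeasure \<delta> s (A n) < top"
      using ennreal_suminf_lessD[OF fin] .
    moreover have "h n > 0" using \<epsilon> by (simp add: h_def)
    ultimately have "hausdorff_premeasure \<delta> s (A n) < hausdorff_premeasure \<delta> s (A n) + h n"
      by (cases "hausdorff_premeasure \<delta> s (A n)") (auto simp: h_def simp flip: ennreal_plus intro!: ennreal_lessI)
    then show ?thesis by (rule hausdorff_premeasure_lessE) (auto intro: less_imp_le)
  qed
  then obtain C where C: "\<And>n. A n \<subseteq> (\<Union>i. C n i)" "\<And>n i. bounded (C n i)" "\<And>n i. diameter (C n i) \<le> \<delta>"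
      "\<And>n. (\<Sum>i. ennreal (diameter (C n i) powr s)) \<le> hausdorff_premeasure \<delta> s (A n) + h n"
    by metis
  define D where "D k = (case prod_decode k of (n, i) \<Rightarrow> C n i)" for k
  have "(\<Union>n. A n) \<subseteq> (\<Union>k. D k)"
  proof
    fix x assume "x \<in> (\<Union>n. A n)"
    then obtain n i where "x \<in> C n i" using C(1) by blast
    then have "x \<in> D (prod_encode (n, i))" by (simp add: D_def)
    then show "x \<in> (\<Union>k. D k)" by blast
  qed
  then have "hausdorff_premeasure \<delta> s (\<Union>n. A n) \<le> (\<Sum>k. ennreal (diameter (D k) powr s))"
    by (rule hausdorff_premeasure_le_suminf) (use C in \<open>auto simp: D_def split: prod.split\<close>)
  also have "\<dots> = (\<Sum>k. (\<lambda>(n, i). ennreal (diameter (C n i) powr s)) (prod_decode k))"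
    by (auto simp: D_def split: prod.split intro!: suminf_cong)
  also have "\<dots> = (\<Sum>n. \<Sum>i. ennreal (diameter (C n i) powr s))"
    by (rule suminf_ennreal_2dimen) simp
  also have "\<dots> \<le> (\<Sum>n. hausdorff_premeasure \<delta> s (A n) + h n)"
    by (intro suminf_le C(4)) auto
  also have "\<dots> = (\<Sum>n. hausdorff_premeasure \<delta> s (A n)) + ennreal \<epsilon>"
    by (subst suminf_add[symmetric]) (auto simp: h)
  finally show "hausdorff_premeasure \<delta> s (\<Union>n. A n) \<le> (\<Sum>n. hausdorff_premeasure \<delta> s (A n)) + ennreal \<epsilon>" .
qed

text \<open>The set itself, followed by empty sets of cost \<open>0 powr s = 0\<close>, is a
  cover.\<close>

lemma hausdorff_premeasure_le_diameter:
  fixes A :: "'a::metric_space set"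
  assumes "bounded A" "diameter A \<le> \<delta>" "\<delta> \<ge> 0"
  shows "hausdorff_premeasure \<delta> s A \<le> ennreal (diameter A powr s)"
proof -
  define C where "C i = (if i = (0::nat) then A else {})" for i
  have "hausdorff_premeasure \<delta> s A \<le> (\<Sum>i. ennreal (diameter (C i) powr s))"
    by (rule hausdorff_premeasure_le_suminf) (use assms in \<open>auto simp: C_def split: if_splits\<close>)
  also have "\<dots> = (\<Sum>i\<in>{0}. ennreal (diameter (C i) powr s))"
    by (rule suminf_finite) (auto simp: C_def)
  finally show ?thesis by (simp add: C_def)
qed

lemma hausdorff_premeasure_empty: "\<delta> \<ge> 0 \<Longrightarrow> hausdorff_premeasure \<delta> s {} = 0"
  using hausdorff_premeasure_le_diameter[of "{}" \<delta> s] by simp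

text \<open>Induction by subadditivity for two sets padded with empty ones. The bound
  \<open>r\<close> is kept apart from \<delta>, so that small sets are charged at their own
  size.\<close>

lemma hausdorff_premeasure_finite_UN_le:
  fixes A :: "'b \<Rightarrow> 'a::metric_space set"
  assumes "finite I" "\<delta> \<ge> 0"
    and "\<And>i. i \<in> I \<Longrightarrow> bounded (A i)" "\<And>i. i \<in> I \<Longrightarrow> diameter (A i) \<le> r" and r: "r \<le> \<delta>" and s: "s \<ge> 0"
  shows "hausdorff_premeasure \<delta> s (\<Union>i\<in>I. A i) \<le> ennreal (real (card I) * r powr s)"
  using assms(1,3,4)
proof (induction I rule: finite_induct)
  case empty
  then show ?case by (simp add: hausdorff_premeasure_empty assms)
next
  case (insert i I)
  define B where "B n = (if n = (0::nat) then A i else if n = 1 then (\<Union>i\<in>I. A i) else {})" for n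
  have "(\<Union>j\<in>insert i I. A j) \<subseteq> (\<Union>n. B n)"
  proof -
    have "B 0 = A i" "B 1 = (\<Union>i\<in>I. A i)" by (simp_all add: B_def)
    then show ?thesis by (metis UN_insert UN_upper Un_least UNIV_I)
  qed
  then have "hausdorff_premeasure \<delta> s (\<Union>j\<in>insert i I. A j) \<le> hausdorff_premeasure \<delta> s (\<Union>n. B n)"
    by (rule hausdorff_premeasure_mono)
  also have "\<dots> \<le> (\<Sum>n. hausdorff_premeasure \<delta> s (B n))"
    by (rule hausdorff_premeasure_countable_subadditive)
  also have "\<dots> = (\<Sum>n\<in>{0,1}. hausdorff_premeasure \<delta> s (B n))"
    by (rule suminf_finite) (use assms in \<open>auto simp: B_def hausdorff_premeasure_empty\<close>)
  also have "\<dots> = hausdorff_premeasure \<delta> s (A i) + hausdorff_premeasure \<delta> s (\<Union>i\<in>I. A i)"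
    by (simp add: B_def)
  also have "\<dots> \<le> ennreal (r powr s) + ennreal (real (card I) * r powr s)"
  proof (rule add_mono)
    have "hausdorff_premeasure \<delta> s (A i) \<le> ennreal (diameter (A i) powr s)"
      using insert.prems r assms(2) by (intro hausdorff_premeasure_le_diameter) (auto intro: order_trans)
    also have "\<dots> \<le> ennreal (r powr s)"
      using insert.prems s by (intro ennreal_leI powr_mono2) (auto simp: diameter_ge_0)
    finally show "hausdorff_premeasure \<delta> s (A i) \<le> ennreal (r powr s)" .
  qed (use insert in auto)
  also have "\<dots> = ennreal (real (card (insert i I)) * r powr s)"
    using insert by (simp add: algebra_simps flip: ennreal_plus)
  finally show ?case .
qed

section \<open>Countable unions, Lipschitz images and limsup sets of measure zero\<close>

lemma hausdorff_measure_UN_eq_0: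
  fixes A :: "nat \<Rightarrow> 'a::metric_space set"
  assumes "\<And>n. hausdorff_measure s (A n) = 0"
  shows "hausdorff_measure s (\<Union>n. A n) = 0"
  unfolding hausdorff_measure_eq_0_iff
proof (intro allI impI)
  fix \<delta> :: real assume "\<delta> > 0"
  then have "hausdorff_premeasure \<delta> s (A n) = 0" for n
    using assms by (simp add: hausdorff_measure_eq_0_iff)
  then show "hausdorff_premeasure \<delta> s (\<Union>n. A n) = 0"
    using hausdorff_premeasure_countable_subadditive[of \<delta> s A] by simp
qed

lemma hausdorff_measure_countable_Union_eq_0:
  assumes "countable F" "\<And>X. X \<in> F \<Longrightarrow> hausdorff_measure s X = 0" 
  shows "hausdorff_measure s (\<Union>F) = 0"
proof (cases "F = {}")
  case True
  then show ?thesis by (simp add: hausdorff_measure_eq_0_iff hausdorff_premeasure_empty)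
next
  case False
  then show ?thesis
    using hausdorff_measure_UN_eq_0[of s "from_nat_into F"] assms
    by (simp add: from_nat_into range_from_nat_into)
qed

text \<open>The image of a cover at scale \<delta> / L is a cover at scale \<delta>, and its cost
  grows by a factor of at most \<open>L powr s\<close>.\<close>

lemma hausdorff_measure_lipschitz_image_eq_0:
  fixes g :: "'a::metric_space \<Rightarrow> 'b::metric_space"
  assumes null: "hausdorff_measure s A = 0" and s: "s \<ge> 0" and L: "L > 0"
    and lip: "\<And>x y. x \<in> A \<Longrightarrow> y \<in> A \<Longrightarrow> dist (g x) (g y) \<le> L * dist x y"
  shows "hausdorff_measure s (g ` A) = 0"
  unfolding hausdorff_measure_eq_0_iff
proof (intro allI impI)
  fix \<delta> :: real assume \<delta>: "\<delta> > 0"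
  have "hausdorff_premeasure \<delta> s (g ` A) \<le> 0 + ennreal \<epsilon>" if \<epsilon>: "\<epsilon> > 0" for \<epsilon>
  proof -
    have "hausdorff_premeasure (\<delta> / L) s A < ennreal (\<epsilon> / L powr s)"
      using null \<delta> L \<epsilon> by (simp add: hausdorff_measure_eq_0_iff)
    then obtain C where C: "A \<subseteq> (\<Union>i. C i)" "\<And>i. bounded (C i)" "\<And>i. diameter (C i) \<le> \<delta> / L"
        "(\<Sum>i. ennreal (diameter (C i) powr s)) < ennreal (\<epsilon> / L powr s)"
      by (rule hausdorff_premeasure_lessE) blast
    \<comment> \<open>The Lipschitz bound holds only on \<open>A\<close>, hence the
      intersection.\<close>
    define D where "D i = g ` (C i \<inter> A)" for i
    have d: "dist x y \<le> L * diameter (C i)" if "x \<in> D i" "y \<in> D i" for x y i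
    proof -
      from that obtain x' y' where xy: "x = g x'" "y = g y'" "x' \<in> C i \<inter> A" "y' \<in> C i \<inter> A"
        unfolding D_def by blast
      have "dist x y \<le> L * dist x' y'" using lip xy by auto
      also have "\<dots> \<le> L * diameter (C i)"
        using diameter_bounded_bound[OF C(2)] xy L by (intro mult_left_mono) auto
      finally show ?thesis .
    qed
    have diam: "diameter (D i) \<le> L * diameter (C i)" for i
      using d[of _ i] L diameter_ge_0[OF C(2), of i] by (intro diameter_leI) auto
    have bdd: "bounded (D i)" for i using d unfolding bounded_two_points by blast
    have "hausdorff_premeasure \<delta> s (g ` A) \<le> (\<Sum>i. ennreal (diameter (D i) powr s))"
    proof (rule hausdorff_premeasure_le_suminf)
      show "g ` A \<subseteq> (\<Union>i. D i)" using C(1) unfolding D_def by blast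
      show "diameter (D i) \<le> \<delta>" for i
        using diam[of i] C(3)[of i] L by (simp add: field_simps)
    qed (rule bdd)
    also have "\<dots> \<le> (\<Sum>i. ennreal (L powr s) * ennreal (diameter (C i) powr s))"
    proof (rule suminf_le)
      fix i
      have "diameter (D i) powr s \<le> (L * diameter (C i)) powr s"
        using diam s diameter_ge_0[OF bdd] by (intro powr_mono2) auto
      then show "ennreal (diameter (D i) powr s) \<le> ennreal (L powr s) * ennreal (diameter (C i) powr s)"
        using L diameter_ge_0[OF C(2), of i] by (simp add: powr_mult ennreal_leI flip: ennreal_mult)
    qed auto
    also have "\<dots> = ennreal (L powr s) * (\<Sum>i. ennreal (diameter (C i) powr s))" by simp
    also have "\<dots> \<le> ennreal (L powr s) * ennreal (\<epsilon> / L powr s)"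
      using C(4) by (intro mult_left_mono) auto
    also have "\<dots> = ennreal \<epsilon>" using L \<epsilon> by (simp flip: ennreal_mult)
    finally show ?thesis by simp
  qed
  then show "hausdorff_premeasure \<delta> s (g ` A) = 0"
    using ennreal_le_epsilon[of 0] by (metis le_zero_eq)
qed

text \<open>Hausdorff-Cantelli lemma: for every \<open>N\<close> the layers with index at least
  \<open>N\<close> cover \<open>E\<close>, and their total cost is bounded by the tail of a
  convergent series.\<close>

lemma hausdorff_measure_limsup_eq_0:
  fixes E :: "'a::metric_space set" and G :: "nat \<Rightarrow> 'b \<Rightarrow> 'a set"
  assumes cover: "\<And>x N. x \<in> E \<Longrightarrow> \<exists>q\<ge>N. x \<in> (\<Union>i\<in>I q. G q i)"
    and fin: "\<And>q. q \<ge> N0 \<Longrightarrow> finite (I q)"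
    and G: "\<And>q i. q \<ge> N0 \<Longrightarrow> i \<in> I q \<Longrightarrow> bounded (G q i)" 
      "\<And>q i. q \<ge> N0 \<Longrightarrow> i \<in> I q \<Longrightarrow> diameter (G q i) \<le> r q"
    and r: "r \<longlonglongrightarrow> 0" and sum: "summable c" 
    and le: "\<And>q. q \<ge> N0 \<Longrightarrow> real (card (I q)) * r q powr s \<le> c q"
    and s: "s \<ge> 0"
  shows "hausdorff_measure s E = 0"
  unfolding hausdorff_measure_eq_0_iff
proof (intro allI impI)
  fix \<delta> :: real assume \<delta>: "\<delta> > 0"
  have "hausdorff_premeasure \<delta> s E \<le> 0 + ennreal \<epsilon>" if \<epsilon>: "\<epsilon> > 0" for \<epsilon>
  proof -
    obtain N1 where N1: "\<And>q. q \<ge> N1 \<Longrightarrow> r q \<le> \<delta>"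
      using order_tendstoD(2)[OF r \<delta>] unfolding eventually_sequentially by (meson less_imp_le)
    obtain N2 where N2: "\<And>n. n \<ge> N2 \<Longrightarrow> norm (\<Sum>i. c (i + n)) < \<epsilon>"
      using suminf_exist_split[OF \<epsilon> sum] by blast
    \<comment> \<open>From \<open>N0\<close> on the hypotheses hold, from \<open>N1\<close> on the
      sets have diameter at most \<delta>, and from \<open>N2\<close> on the tail is below
      \<epsilon>.\<close>
    define N where "N = max N0 (max N1 N2)"
    have c0: "c q \<ge> 0" if "q \<ge> N0" for q
      using le[OF that] by (smt (verit) mult_nonneg_nonneg of_nat_0_le_iff powr_ge_zero)
    have "E \<subseteq> (\<Union>n. \<Union>i\<in>I (n + N). G (n + N) i)"
      using cover[of _ N] by (force simp: le_iff_add add.commute)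
    then have "hausdorff_premeasure \<delta> s E \<le> hausdorff_premeasure \<delta> s (\<Union>n. \<Union>i\<in>I (n + N). G (n + N) i)"
      by (rule hausdorff_premeasure_mono)
    also have "\<dots> \<le> (\<Sum>n. hausdorff_premeasure \<delta> s (\<Union>i\<in>I (n + N). G (n + N) i))"
      by (rule hausdorff_premeasure_countable_subadditive)
    also have "\<dots> \<le> (\<Sum>n. ennreal (c (n + N)))"
    proof (rule suminf_le)
      fix n
      have "n + N \<ge> N0" "n + N \<ge> N1" by (auto simp: N_def)
      then have "hausdorff_premeasure \<delta> s (\<Union>i\<in>I (n + N). G (n + N) i) \<le> ennreal (real (card (I (n + N))) * r (n + N) powr s)"
        using \<delta> N1 fin G s by (intro hausdorff_premeasure_finite_UN_le) auto
      also have "\<dots> \<le> ennreal (c (n + N))" using le[OF \<open>n + N \<ge> N0\<close>] by (rule ennreal_leI)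
      finally show "hausdorff_premeasure \<delta> s (\<Union>i\<in>I (n + N). G (n + N) i) \<le> ennreal (c (n + N))" .
    qed auto
    also have "\<dots> = ennreal (\<Sum>n. c (n + N))"
      using sum c0 by (intro suminf_ennreal2) (auto simp: N_def summable_iff_shift)
    also have "\<dots> \<le> ennreal \<epsilon>" 
    proof (rule ennreal_leI)
      have "N \<ge> N2" by (simp add: N_def)
      then show "(\<Sum>n. c (n + N)) \<le> \<epsilon>" using N2[of N] by simp
    qed
    finally show ?thesis by simp
  qed
  then show "hausdorff_premeasure \<delta> s E = 0"
    using ennreal_le_epsilon[of 0] by (metis le_zero_eq)
qed

subsection \<open>Counting grid points near a curved graph\<close>

text \<open>The set lies in the box of half-widths \<open>R\<close> around any one of its elements.
  Bounding differences only avoids naming a centre, which suits grids with an arbitrary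
  shift.\<close>

lemma card_int_box_le:
  fixes S :: "('d::finite \<Rightarrow> int) set" and R :: "'d \<Rightarrow> real"
  assumes close: "\<And>a b i. a \<in> S \<Longrightarrow> b \<in> S \<Longrightarrow> real_of_int \<bar>a i - b i\<bar> \<le> R i"
    and R: "\<And>i. R i \<ge> 0"
  shows "finite S \<and> real (card S) \<le> (\<Prod>i\<in>UNIV. 2 * R i + 1)"
proof (cases "S = {}")
  case True
  then show ?thesis using R by (auto intro!: prod_nonneg add_nonneg_nonneg mult_nonneg_nonneg)
next
  case False
  then obtain p where p: "p \<in> S" by blast
  define I where "I i = {p i - \<lfloor>R i\<rfloor> .. p i + \<lfloor>R i\<rfloor>}" for i
  have sub: "S \<subseteq> PiE UNIV I"
  proof
    fix a assume "a \<in> S"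
    then have "\<bar>a i - p i\<bar> \<le> \<lfloor>R i\<rfloor>" for i
      using close[OF _ p] by (simp add: le_floor_iff)
    then show "a \<in> PiE UNIV I"
      unfolding I_def by (auto simp: abs_le_iff) (smt (verit))+
  qed
  have fin: "finite (PiE UNIV I)" by (intro finite_PiE) (auto simp: I_def)
  have "real (card S) \<le> real (card (PiE UNIV I))"
    using card_mono[OF fin sub] by simp
  also have "\<dots> = (\<Prod>i\<in>UNIV. real (card (I i)))"
    by (simp add: card_PiE)
  also have "\<dots> \<le> (\<Prod>i\<in>UNIV. 2 * R i + 1)"
  proof (rule prod_mono)
    fix i
    have "real (card (I i)) = 2 * real_of_int \<lfloor>R i\<rfloor> + 1"
      using R[of i] by (simp add: I_def)
    then show "0 \<le> real (card (I i)) \<and> real (card (I i)) \<le> 2 * R i + 1" by simp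
  qed
  finally show ?thesis using finite_subset[OF sub fin] by blast
qed

lemma card_le_fibres:
  assumes "finite S" and "\<And>y. y \<in> g ` S \<Longrightarrow> real (card {x \<in> S. g x = y}) \<le> N"
  shows "real (card S) \<le> real (card (g ` S)) * N"
proof -
  have "card S = (\<Sum>y\<in>g ` S. card {x \<in> S. g x = y})"
    using sum.image_gen[OF assms(1), of "\<lambda>_. 1::nat" g] by simp
  then have "real (card S) = (\<Sum>y\<in>g ` S. real (card {x \<in> S. g x = y}))" by simp
  also have "\<dots> \<le> real (card (g ` S)) * N" using assms(2) by (rule sum_bounded_above)
  finally show ?thesis .
qed

definition grid_point :: "nat \<Rightarrow> real ^ 'd \<Rightarrow> ('d \<Rightarrow> int) \<Rightarrow> real ^ 'd" where
  "grid_point q \<mu> a = (\<chi> i. (real_of_int (a i) + \<mu> $ i) / real q)"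

text \<open>Solutions are encoded by their integer numerators, so that they can be counted in
  integer boxes. The nearby integer is chosen for each component separately, which amounts to the
  maximum norm.\<close>

definition near_points ::
    "(real ^ 'd) set \<Rightarrow> (real ^ 'd \<Rightarrow> real ^ 'm) \<Rightarrow> nat \<Rightarrow> real \<Rightarrow> real ^ 'd \<Rightarrow> real ^ 'm \<Rightarrow> ('d \<Rightarrow> int) set" where
  "near_points B f q \<delta> \<mu> \<gamma> = {a. grid_point q \<mu> a \<in> B \<and>
     (\<forall>j. \<exists>b::int. \<bar>real q * f (grid_point q \<mu> a) $ j - \<gamma> $ j - b\<bar> < \<delta>)}"

text \<open>Integer division is the floor of the real quotient, and taking floors increases a
  difference by less than 1.\<close>

lemma abs_div_diff_le:
  fixes a b \<rho> :: int
  assumes "\<rho> > 0" "real_of_int \<bar>a - b\<bar> \<le> r"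
  shows "real_of_int \<bar>a div \<rho> - b div \<rho>\<bar> \<le> r / real_of_int \<rho> + 1"
proof -
  have fl: "a div \<rho> = \<lfloor>real_of_int a / real_of_int \<rho>\<rfloor>" for a by (simp add: floor_divide_of_int_eq)
  have "\<bar>real_of_int a / \<rho> - real_of_int b / \<rho>\<bar> \<le> r / \<rho>"
    using assms by (simp add: diff_divide_distrib[symmetric] abs_divide divide_right_mono)
  then show ?thesis unfolding fl by linarith
qed

text \<open>Abstract data for the count: \<open>\<iota>\<close> embeds the component indices into
  the coordinates, \<open>e\<close> is the direction of the windows, and \<open>w\<close> plays the
  role of the derivative of \<open>f\<close> along \<open>e\<close>. The constant \<open>K\<close>
  controls the second-order error, \<open>L\<close> the size of \<open>w\<close>, and
  \<open>c\<close> is a Lipschitz constant for recovering the coordinates in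
  \<open>range \<iota>\<close> from \<open>w\<close> when the others are fixed.\<close>

context
  fixes B :: "(real ^ 'd) set" and f w :: "real ^ 'd \<Rightarrow> real ^ 'm"
    and \<iota> :: "'m \<Rightarrow> 'd" and e :: 'd and K L c :: real
  assumes inj: "inj \<iota>" and e: "e \<in> range \<iota>" and B: "B \<subseteq> unit_cube"
    and K: "K \<ge> 0" and L: "L \<ge> 0" and c: "c \<ge> 0"
    and taylor: "\<And>z t j. z \<in> B \<Longrightarrow> z + t *\<^sub>R axis e 1 \<in> B \<Longrightarrow>
          \<bar>f (z + t *\<^sub>R axis e 1) $ j - f z $ j - t * w z $ j\<bar> \<le> K * t\<^sup>2"
    and w_bound: "\<And>z j. z \<in> B \<Longrightarrow> \<bar>w z $ j\<bar> \<le> L"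
    and w_sep: "\<And>z z' r i. z \<in> B \<Longrightarrow> z' \<in> B \<Longrightarrow> (\<And>i. i \<notin> range \<iota> \<Longrightarrow> z $ i = z' $ i) \<Longrightarrow>
          (\<And>j. \<bar>w z $ j - w z' $ j\<bar> \<le> r) \<Longrightarrow> \<bar>z $ i - z' $ i\<bar> \<le> c * r"
begin

text \<open>\<open>A\<close> is the set of all solutions, and \<open>key\<close> names the window of
  a point by dividing its \<open>e\<close>-coordinate by \<open>\<rho>\<close>. \<open>A0\<close>
  keeps the first solution of each window; \<open>Ax x\<close> keeps those that satisfy the
  necessary condition for another solution \<open>x\<close> steps further on.\<close>

context
  fixes q :: nat and \<delta> :: real and \<mu> :: "real ^ 'd" and \<gamma> :: "real ^ 'm"
    and A :: "('d \<Rightarrow> int) set" and P :: "('d \<Rightarrow> int) \<Rightarrow> real ^ 'd"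
    and \<rho> :: int and key :: "('d \<Rightarrow> int) \<Rightarrow> 'd \<Rightarrow> int" and A0 :: "('d \<Rightarrow> int) set"
    and Ax :: "int \<Rightarrow> ('d \<Rightarrow> int) set"
  assumes q: "q \<ge> 1" and \<delta>: "0 < \<delta>" "\<delta> \<le> 1" and large: "\<delta> ^ (2 * CARD('m) + 1) * real q \<ge> 1"
  defines "P \<equiv> grid_point q \<mu>" and "A \<equiv> near_points B f q \<delta> \<mu> \<gamma>"
    and "\<rho> \<equiv> \<lfloor>sqrt (real q * \<delta>)\<rfloor>"
    and "key \<equiv> \<lambda>a i. if i = e then a i div \<rho> else a i"
    and "A0 \<equiv> {p \<in> A. \<forall>a\<in>A. key a = key p \<longrightarrow> p e \<le> a e}"
    and "Ax \<equiv> \<lambda>x. {p \<in> A0. \<forall>j. \<exists>b::int. \<bar>x * w (P p) $ j - b\<bar> \<le> (2 + K) * \<delta>}"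
begin

text \<open>As \<delta> \<le> 1, removing the factor \<delta>^(2m) from the left side of
  \<open>large\<close> can only increase it.\<close>

lemma q\<delta>_ge_1: "real q * \<delta> \<ge> 1"
proof -
  have "1 \<le> \<delta> ^ (2 * CARD('m)) * (real q * \<delta>)" using large by (simp add: algebra_simps)
  also have "\<dots> \<le> 1 * (real q * \<delta>)"
    using \<delta> by (intro mult_right_mono power_le_one) auto
  finally show ?thesis by simp
qed

lemma \<rho>_ge_1: "\<rho> \<ge> 1"
  using q\<delta>_ge_1 unfolding \<rho>_def by (simp add: le_floor_iff)

text \<open>This keeps the second-order error inside a window, after multiplication by
  \<open>q\<close>, at most \<open>K * \<delta>\<close>.\<close>

lemma \<rho>_sq: "real_of_int \<rho> * real_of_int \<rho> \<le> real q * \<delta>"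
proof -
  have "real_of_int \<rho> \<le> sqrt (real q * \<delta>)" unfolding \<rho>_def by simp
  then have "real_of_int \<rho> * real_of_int \<rho> \<le> sqrt (real q * \<delta>) * sqrt (real q * \<delta>)"
    using \<rho>_ge_1 q\<delta>_ge_1 by (intro mult_mono) auto
  also have "\<dots> = real q * \<delta>" using \<delta> by (intro real_sqrt_mult_self[THEN trans]) auto
  finally show ?thesis .
qed

lemma \<rho>_le_q: "real_of_int \<rho> \<le> real q"
proof -
  have "real_of_int \<rho> \<le> real_of_int \<rho> * real_of_int \<rho>" using \<rho>_ge_1 by (simp add: mult_le_cancel_left1)
  also note \<rho>_sq
  also have "real q * \<delta> \<le> real q * 1" using \<delta> by (intro mult_left_mono) auto
  finally show ?thesis by simp
qed

text \<open>The exponent 2m + 1 enters here: the square of \<delta>^m sqrt(q \<delta>) is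
  \<delta>^(2m+1) q \<ge> 1. Rounding down loses at most a factor 2, since \<open>\<rho>\<close> is
  at least 1.\<close>

lemma inverse_\<rho>_le: "1 / real_of_int \<rho> \<le> 2 * \<delta> ^ CARD('m)"
proof -
  define s where "s = sqrt (real q * \<delta>)"
  have s1: "s \<ge> 1" using q\<delta>_ge_1 by (simp add: s_def)
  have "s < real_of_int \<rho> + 1" unfolding \<rho>_def s_def by linarith
  then have s2: "s \<le> 2 * real_of_int \<rho>" using \<rho>_ge_1 by (smt (verit) of_int_1_le_iff)
  have "(\<delta> ^ CARD('m) * s)\<^sup>2 = \<delta> ^ (2 * CARD('m) + 1) * real q"
    using \<delta> by (simp add: s_def power_mult_distrib power_mult[symmetric] mult.commute)
  then have "1 \<le> (\<delta> ^ CARD('m) * s)\<^sup>2" using large by simp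
  then have "1 \<le> \<delta> ^ CARD('m) * s"
    using \<delta> s1 by (smt (verit) mult_nonneg_nonneg power2_le_imp_le one_power2 zero_le_power)
  also have "\<dots> \<le> \<delta> ^ CARD('m) * (2 * real_of_int \<rho>)"
    using \<delta> s2 by (intro mult_left_mono) auto
  finally show ?thesis using \<rho>_ge_1 by (simp add: field_simps)
qed

lemma P_nth: "P a $ i = (real_of_int (a i) + \<mu> $ i) / real q"
  by (simp add: P_def grid_point_def)

lemma P_diff: "P a $ i - P b $ i = (real_of_int (a i) - real_of_int (b i)) / real q"
  by (simp add: P_nth diff_divide_distrib[symmetric])

lemma A_D: "a \<in> A \<Longrightarrow> P a \<in> B"
  "a \<in> A \<Longrightarrow> \<exists>b::int. \<bar>real q * f (P a) $ j - \<gamma> $ j - b\<bar> < \<delta>"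
  by (simp_all add: A_def near_points_def P_def)

lemma A_diff:
  assumes "a \<in> A" "b \<in> A"
  shows "real_of_int \<bar>a i - b i\<bar> \<le> real q"
proof -
  have "P a \<in> unit_cube" "P b \<in> unit_cube" using A_D(1) assms B by blast+
  then have "0 \<le> P a $ i" "P a $ i \<le> 1" "0 \<le> P b $ i" "P b $ i \<le> 1"
    by (simp_all add: mem_box_cart)
  then have "\<bar>P a $ i - P b $ i\<bar> \<le> 1" by linarith
  then show ?thesis using q by (simp add: P_diff abs_divide)
qed

lemma finite_A: "finite A"
  using card_int_box_le[of A "\<lambda>_. real q"] A_diff by simp

text \<open>First solutions of the same window share their \<open>e\<close>-coordinate by
  minimality, and \<open>key\<close> retains all other coordinates.\<close>

lemma inj_key: "inj_on key A0"
proof (rule inj_onI)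
  fix a b assume ab: "a \<in> A0" "b \<in> A0" "key a = key b"
  then have "a e = b e" unfolding A0_def by (metis (mono_tags, lifting) mem_Collect_eq order_antisym)
  moreover have "a i = b i" if "i \<noteq> e" for i
    using fun_cong[OF ab(3), of i] that by (simp add: key_def)
  ultimately show "a = b" by (metis ext)
qed

text \<open>By injectivity of \<open>key\<close> it suffices to count windows: O(q / \<rho>)
  positions along \<open>e\<close> and O(q) along every other coordinate.\<close>

lemma card_A0: "real (card A0) \<le> 5 ^ CARD('d) * real q ^ CARD('d) / real_of_int \<rho>"
proof -
  define R where "R i = (if i = e then real q / \<rho> + 1 else real q)" for i
  have q': "real q \<ge> 1" using q by simp
  have sub: "A0 \<subseteq> A" by (auto simp: A0_def)
  have "real (card (key ` A0)) \<le> (\<Prod>i\<in>UNIV. 2 * R i + 1)"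
  proof (rule conjunct2[OF card_int_box_le])
    fix a b i assume "a \<in> key ` A0" "b \<in> key ` A0"
    then obtain a' b' where ab: "a' \<in> A" "b' \<in> A" "a = key a'" "b = key b'" using sub by blast
    show "real_of_int \<bar>a i - b i\<bar> \<le> R i"
      using abs_div_diff_le[OF _ A_diff[OF ab(1,2), of i], of \<rho>] A_diff[OF ab(1,2), of i] \<rho>_ge_1
      by (auto simp: R_def ab key_def)
  qed (use \<rho>_ge_1 in \<open>auto simp: R_def\<close>)
  \<comment> \<open>The factor 5 absorbs the additive terms: 2 (q / \<rho> + 1) + 1 \<le> 5 q /
    \<rho> because \<rho> \<le> q.\<close>
  also have "\<dots> \<le> (\<Prod>i\<in>UNIV. 5 * real q * (if i = e then 1 / \<rho> else 1))"
  proof (rule prod_mono)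
    fix i
    have "real q / \<rho> \<ge> 1" using \<rho>_le_q \<rho>_ge_1 by simp
    then show "0 \<le> 2 * R i + 1 \<and> 2 * R i + 1 \<le> 5 * real q * (if i = e then 1 / \<rho> else 1)"
      using q' by (simp add: R_def)
  qed
  also have "\<dots> = 5 ^ CARD('d) * real q ^ CARD('d) / \<rho>"
    by (simp add: prod.distrib prod.delta)
  finally show ?thesis by (simp add: card_image[OF inj_key])
qed

text \<open>Points are grouped by the integer vector near x w together with their coordinates
  outside \<open>range \<iota>\<close>. There are O(x^m q^(d-m)) groups, and each has O((q \<delta>
  / x)^m / \<rho>) points, as \<open>w\<close> varies little within it.\<close>

lemma card_Ax:
  assumes x: "x \<ge> 1" "x < \<rho>"
  shows "real (card (Ax x)) \<le> ((4 * (L + 2 + K) + 1) * (4 * c * (2 + K) + 3)) ^ CARD('m)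
           * 3 ^ CARD('d) * real q ^ CARD('d) * \<delta> ^ CARD('m) / \<rho>"
proof -
  define T where "T = 4 * (L + 2 + K) + 1"
  define S where "S = 4 * c * (2 + K) + 3"
  define y where "y = real_of_int x"
  have y1: "y \<ge> 1" using x by (simp add: y_def)
  have yr: "y * \<rho> \<le> real q * \<delta>"
  proof -
    have "y * \<rho> \<le> real_of_int \<rho> * real_of_int \<rho>"
      using x by (intro mult_right_mono) (auto simp: y_def)
    then show ?thesis using \<rho>_sq by linarith
  qed
  have yq: "y \<le> real q * \<delta>"
  proof -
    have "y * 1 \<le> y * \<rho>" using y1 \<rho>_ge_1 by (intro mult_left_mono) auto
    then show ?thesis using yr by simp
  qed
  have q': "real q \<ge> 1" using q by simp
  have \<rho>': "real_of_int \<rho> \<ge> 1" using \<rho>_ge_1 by simp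
  have T: "T \<ge> 1" and S: "S \<ge> 3" using K L c by (simp_all add: T_def S_def)
  have sub: "Ax x \<subseteq> A0" "A0 \<subseteq> A" by (auto simp: Ax_def A0_def)
  define bb where "bb p j = (SOME b::int. \<bar>x * w (P p) $ j - b\<bar> \<le> (2 + K) * \<delta>)" for p j
  have bb: "\<bar>x * w (P p) $ j - bb p j\<bar> \<le> (2 + K) * \<delta>" if "p \<in> Ax x" for p j
    using that unfolding Ax_def bb_def by (auto intro: someI_ex)
  \<comment> \<open>The integer vector is stored in the slots of \<open>range \<iota>\<close>, so
    that tags are again integer points indexed by coordinates.\<close>
  define tag where "tag p i = (if i \<in> range \<iota> then bb p (inv \<iota> i) else p i)" for p i
  have fin: "finite (Ax x)" using finite_A sub by (meson finite_subset)
  have fibre: "real (card (Ax x)) \<le> real (card (tag ` Ax x)) * ((S * (real q * \<delta> / y)) ^ CARD('m) / \<rho>)"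
  proof (rule card_le_fibres[OF fin])
    fix t assume "t \<in> tag ` Ax x"
    define F where "F = {p \<in> Ax x. tag p = t}"
    \<comment> \<open>Two points with the same tag have \<open>w\<close>-values within 2 (2 + K)
      \<delta> / y. Separation multiplies this by \<open>c\<close>, and passing to numerators by
      \<open>q\<close>.\<close>
    define h where "h = 2 * c * (2 + K) * (real q * \<delta> / y)"
    have h0: "h \<ge> 0" using c K \<delta> y1 by (simp add: h_def)
    \<comment> \<open>Along \<open>e\<close> windows are counted instead of points, and coordinates
      outside \<open>range \<iota>\<close> are fixed by the tag.\<close>
    define R where "R i = (if i = e then h / \<rho> + 1 else if i \<in> range \<iota> then h else 0)" for i
    have same: "a i = b i" if "a \<in> F" "b \<in> F" "i \<notin> range \<iota>" for a b i
      using that unfolding F_def tag_def by (auto simp: fun_eq_iff) metis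
    have same': "bb a j = bb b j" if "a \<in> F" "b \<in> F" for a b j
    proof -
      have "tag a (\<iota> j) = tag b (\<iota> j)" using that by (simp add: F_def)
      then show ?thesis by (simp add: tag_def inv_f_f[OF inj])
    qed
    have d: "real_of_int \<bar>a i - b i\<bar> \<le> h" if ab: "a \<in> F" "b \<in> F" for a b i
    proof -
      have Ax: "a \<in> Ax x" "b \<in> Ax x" using ab by (auto simp: F_def)
      have "\<bar>P a $ i - P b $ i\<bar> \<le> c * (2 * ((2 + K) * \<delta>) / y)"
      proof (rule w_sep)
        show "P a \<in> B" "P b \<in> B" using Ax sub A_D(1) by blast+
        show "P a $ i = P b $ i" if "i \<notin> range \<iota>" for i
          using same[OF ab that] by (simp add: P_nth)
        show "\<bar>w (P a) $ j - w (P b) $ j\<bar> \<le> 2 * ((2 + K) * \<delta>) / y" for j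
        proof -
          have "\<bar>y * w (P a) $ j - y * w (P b) $ j\<bar> \<le> 2 * ((2 + K) * \<delta>)"
            using bb[OF Ax(1), of j] bb[OF Ax(2), of j] same'[OF ab, of j] unfolding y_def
            by (simp only: abs_le_iff) linarith
          then have "y * \<bar>w (P a) $ j - w (P b) $ j\<bar> \<le> 2 * ((2 + K) * \<delta>)"
            using y1 by (simp add: abs_mult right_diff_distrib[symmetric])
          then show ?thesis using y1 by (simp add: pos_le_divide_eq mult.commute[of y])
        qed
      qed
      then have "real_of_int \<bar>a i - b i\<bar> / real q \<le> c * (2 * ((2 + K) * \<delta>) / y)"
        by (simp add: P_diff abs_divide)
      then have "real_of_int \<bar>a i - b i\<bar> \<le> c * (2 * ((2 + K) * \<delta>) / y) * real q"
        using q' by (simp add: pos_divide_le_eq)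
      then show ?thesis by (simp add: h_def mult_ac)
    qed
    have "real (card (key ` F)) \<le> (\<Prod>i\<in>UNIV. 2 * R i + 1)"
    proof (rule conjunct2[OF card_int_box_le])
      fix a b i assume "a \<in> key ` F" "b \<in> key ` F"
      then obtain a' b' where ab: "a' \<in> F" "b' \<in> F" "a = key a'" "b = key b'" by blast
      show "real_of_int \<bar>a i - b i\<bar> \<le> R i"
        using abs_div_diff_le[OF _ d[OF ab(1,2), of i], of \<rho>] d[OF ab(1,2), of i] \<rho>_ge_1
          same[OF ab(1,2), of i]
        by (auto simp: R_def ab key_def)
    qed (use \<rho>_ge_1 h0 in \<open>auto simp: R_def\<close>)
    also have "\<dots> \<le> (\<Prod>i\<in>UNIV. (if i \<in> range \<iota> then S * (real q * \<delta> / y) else 1) * (if i = e then 1 / \<rho> else 1))"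
    proof (rule prod_mono)
      fix i
      have 1: "real q * \<delta> / y \<ge> 1" using yq y1 by simp
      \<comment> \<open>Since x < \<rho>, the scale q \<delta> / y is at least one window length, so
        the additive 3 in the window count is absorbed into the constant \<open>S\<close>.\<close>
      have 2: "real q * \<delta> / y / \<rho> \<ge> 1" using yr y1 \<rho>' by simp
      have "2 * h + 3 \<le> S * (real q * \<delta> / y)"
      proof -
        have "2 * h + 3 = 4 * c * (2 + K) * (real q * \<delta> / y) + 3" by (simp add: h_def)
        also have "\<dots> \<le> S * (real q * \<delta> / y)"
          using 1 unfolding S_def distrib_right by linarith
        finally show ?thesis .
      qed
      moreover have "2 * (h / \<rho> + 1) + 1 \<le> S * (real q * \<delta> / y) * (1 / \<rho>)"
      proof -
        have "2 * (h / \<rho> + 1) + 1 = 4 * c * (2 + K) * (real q * \<delta> / y / \<rho>) + 3"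
          by (simp add: h_def)
        also have "\<dots> \<le> S * (real q * \<delta> / y / \<rho>)"
          using 2 unfolding S_def distrib_right by linarith
        finally show ?thesis by simp
      qed
      moreover have "0 \<le> R i" using h0 \<rho>' by (simp add: R_def)
      ultimately show "0 \<le> 2 * R i + 1 \<and> 2 * R i + 1 \<le>
           (if i \<in> range \<iota> then S * (real q * \<delta> / y) else 1) * (if i = e then 1 / \<rho> else 1)"
        using e by (auto simp: R_def)
    qed
    also have "\<dots> = (S * (real q * \<delta> / y)) ^ CARD('m) / \<rho>"
    proof -
      have "(\<Prod>i\<in>UNIV. if i \<in> range \<iota> then S * (real q * \<delta> / y) else 1) = (S * (real q * \<delta> / y)) ^ CARD('m)"
        by (subst prod.If_cases) (auto simp: card_image[OF inj])
      then show ?thesis by (simp add: prod.distrib prod.delta)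
    qed
    finally have "real (card (key ` F)) \<le> (S * (real q * \<delta> / y)) ^ CARD('m) / \<rho>" .
    moreover have "inj_on key F" using sub by (intro inj_on_subset[OF inj_key]) (auto simp: F_def)
    ultimately show "real (card {p \<in> Ax x. tag p = t}) \<le> (S * (real q * \<delta> / y)) ^ CARD('m) / \<rho>"
      by (simp add: card_image F_def)
  qed
  have "real (card (tag ` Ax x)) \<le> (\<Prod>i\<in>UNIV. 2 * (if i \<in> range \<iota> then 2 * ((L + 2 + K) * y) else real q) + 1)"
  proof (rule conjunct2[OF card_int_box_le])
    fix a b i assume "a \<in> tag ` Ax x" "b \<in> tag ` Ax x"
    then obtain a' b' where ab: "a' \<in> Ax x" "b' \<in> Ax x" "a = tag a'" "b = tag b'" by blast
    \<comment> \<open>The error (2 + K) \<delta> is at most (2 + K) y because \<delta> \<le> 1 \<le>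
      y.\<close>
    have bd: "\<bar>real_of_int (bb p j)\<bar> \<le> (L + 2 + K) * y" if "p \<in> Ax x" for p j
    proof -
      have "\<bar>x * w (P p) $ j\<bar> \<le> y * L"
        using w_bound[OF A_D(1), of p j] that sub y1 by (auto simp: y_def abs_mult intro!: mult_left_mono)
      moreover have "(2 + K) * \<delta> \<le> (2 + K) * y" using K \<delta> y1 by (intro mult_left_mono) auto
      ultimately show ?thesis using bb[OF that, of j] unfolding distrib_right by (simp add: abs_le_iff mult.commute[of L])
    qed
    show "real_of_int \<bar>a i - b i\<bar> \<le> (if i \<in> range \<iota> then 2 * ((L + 2 + K) * y) else real q)"
    proof (cases "i \<in> range \<iota>")
      case True
      then show ?thesis
        using bd[OF ab(1), of "inv \<iota> i"] bd[OF ab(2), of "inv \<iota> i"] unfolding ab tag_def by simp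
    next
      case False
      then show ?thesis using A_diff[of a' b' i] ab sub by (auto simp: tag_def)
    qed
  qed (use L K y1 in auto)
  also have "\<dots> \<le> (\<Prod>i\<in>UNIV. if i \<in> range \<iota> then T * y else 3 * real q)"
    using L K y1 q' by (intro prod_mono) (auto simp: T_def algebra_simps)
  also have "\<dots> = (T * y) ^ CARD('m) * (3 * real q) ^ (CARD('d) - CARD('m))"
  proof -
    have "card (- range \<iota>) = CARD('d) - CARD('m)"
      by (simp add: Compl_eq_Diff_UNIV card_Diff_subset card_image[OF inj])
    then show ?thesis by (subst prod.If_cases) (auto simp: card_image[OF inj])
  qed
  finally have tags: "real (card (tag ` Ax x)) * ((S * (real q * \<delta> / y)) ^ CARD('m) / \<rho>)
     \<le> ((T * y) ^ CARD('m) * (3 * real q) ^ (CARD('d) - CARD('m))) * ((S * (real q * \<delta> / y)) ^ CARD('m) / \<rho>)"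
    using S \<rho>' \<delta> y1 by (intro mult_right_mono) auto
  note order_trans[OF fibre tags]
  \<comment> \<open>The powers of \<open>y\<close> in the number of tags and in the fibre bound
    cancel, so the estimate is the same for every \<open>x\<close>.\<close>
  also have "((T * y) ^ CARD('m) * (3 * real q) ^ (CARD('d) - CARD('m))) * ((S * (real q * \<delta> / y)) ^ CARD('m) / \<rho>)
     = (T * S) ^ CARD('m) * (3 ^ (CARD('d) - CARD('m)) * (real q ^ (CARD('d) - CARD('m)) * real q ^ CARD('m))) * \<delta> ^ CARD('m) / \<rho>"
    using y1 by (simp add: power_mult_distrib power_divide)
  also have "real q ^ (CARD('d) - CARD('m)) * real q ^ CARD('m) = real q ^ CARD('d)"
    using card_inj_on_le[OF inj, of UNIV] by (simp add: power_add[symmetric])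
  also have "(T * S) ^ CARD('m) * (3 ^ (CARD('d) - CARD('m)) * real q ^ CARD('d)) * \<delta> ^ CARD('m) / \<rho>
     \<le> (T * S) ^ CARD('m) * (3 ^ CARD('d) * real q ^ CARD('d)) * \<delta> ^ CARD('m) / \<rho>"
    using T S \<rho>' \<delta> by (intro divide_right_mono mult_right_mono mult_left_mono power_increasing) auto
  finally show ?thesis by (simp add: T_def S_def mult.assoc)
qed

text \<open>Each solution lies \<open>x\<close> steps after the first solution \<open>p\<close> of
  its window. Subtracting the two near-integer relations costs 2 \<delta> and linearising costs K
  \<delta>, which places \<open>p\<close> in \<open>Ax x\<close> when \<open>x\<close> is
  nonzero.\<close>

lemma A_cover:
  "A \<subseteq> A0 \<union> (\<Union>x\<in>{1..<\<rho>}. (\<lambda>p. p(e := p e + x)) ` Ax x)"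
proof
  fix a assume a: "a \<in> A"
  define F where "F = {p \<in> A. key p = key a}"
  have "finite F" "F \<noteq> {}" using finite_A a by (auto simp: F_def)
  then obtain p where p: "p \<in> F" "\<And>b. b \<in> F \<Longrightarrow> p e \<le> b e"
    using ex_min_if_finite[of "(\<lambda>p. p e) ` F"] by (fastforce simp: not_less)
  have pA0: "p \<in> A0" using p by (auto simp: F_def A0_def)
  have pA: "p \<in> A" using p by (simp add: F_def)
  define x where "x = a e - p e"
  have x0: "x \<ge> 0" using p(2)[of a] a by (simp add: x_def F_def)
  have k: "key p i = key a i" for i using p(1) by (simp add: F_def)
  have ap: "a = p(e := p e + x)"
  proof
    fix i show "a i = (p(e := p e + x)) i"
      using k[of i] by (simp add: key_def x_def split: if_splits)
  qed
  have "a e div \<rho> = p e div \<rho>" using k[of e] by (simp add: key_def)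
  \<comment> \<open>Both points have the same quotient by \<open>\<rho>\<close>, so the offset is a
    difference of remainders and therefore below \<open>\<rho>\<close>.\<close>
  then have "x = a e mod \<rho> - p e mod \<rho>"
    unfolding x_def by (metis (no_types) add_diff_cancel_left mult_div_mod_eq)
  then have x\<rho>: "x < \<rho>"
    using \<rho>_ge_1 pos_mod_bound[of \<rho> "a e"] pos_mod_sign[of \<rho> "p e"] by linarith
  show "a \<in> A0 \<union> (\<Union>x\<in>{1..<\<rho>}. (\<lambda>p. p(e := p e + x)) ` Ax x)"
  proof (cases "x = 0")
    case True
    then show ?thesis using ap pA0 by simp
  next
    case False
    have "p \<in> Ax x" unfolding Ax_def
    proof (intro CollectI conjI allI pA0)
      fix j
      define t where "t = real_of_int x / real q"
      have Pa: "P a = P p + t *\<^sub>R axis e 1"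
        by (simp add: vec_eq_iff P_nth ap axis_def t_def add_divide_distrib)
      have "\<bar>f (P a) $ j - f (P p) $ j - t * w (P p) $ j\<bar> \<le> K * t\<^sup>2"
        using taylor[of "P p" t j] A_D(1)[OF pA] A_D(1)[OF a] Pa by simp
      then have "real q * \<bar>f (P a) $ j - f (P p) $ j - t * w (P p) $ j\<bar> \<le> real q * (K * t\<^sup>2)"
        by (intro mult_left_mono) auto
      moreover have "real q * \<bar>f (P a) $ j - f (P p) $ j - t * w (P p) $ j\<bar> =
          \<bar>real q * f (P a) $ j - real q * f (P p) $ j - x * w (P p) $ j\<bar>"
      proof -
        have "real q * t = x" using q by (simp add: t_def)
        then have "real q * f (P a) $ j - real q * f (P p) $ j - x * w (P p) $ j =
            real q * (f (P a) $ j - f (P p) $ j - t * w (P p) $ j)"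
          by (simp add: right_diff_distrib flip: mult.assoc)
        then show ?thesis by (simp add: abs_mult)
      qed
      moreover have "real q * (K * t\<^sup>2) \<le> K * \<delta>"
      proof -
        have "real_of_int x * real_of_int x \<le> real_of_int \<rho> * real_of_int \<rho>"
          using x0 x\<rho> by (intro mult_mono) auto
        then have "real_of_int x * real_of_int x \<le> real q * \<delta>" using \<rho>_sq by linarith
        then have "real_of_int x * real_of_int x / real q \<le> \<delta>" using q by (simp add: field_simps)
        then have "K * (real_of_int x * real_of_int x / real q) \<le> K * \<delta>" using K by (intro mult_left_mono)
        then show ?thesis using q by (simp add: t_def power2_eq_square)
      qed
      moreover obtain b1 b2 :: int where
        "\<bar>real q * f (P a) $ j - \<gamma> $ j - b1\<bar> < \<delta>" "\<bar>real q * f (P p) $ j - \<gamma> $ j - b2\<bar> < \<delta>"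
        using A_D(2)[OF a] A_D(2)[OF pA] by blast
      ultimately have "\<bar>x * w (P p) $ j - real_of_int (b1 - b2)\<bar> \<le> (2 + K) * \<delta>"
        unfolding of_int_diff distrib_right by linarith
      then show "\<exists>b::int. \<bar>x * w (P p) $ j - b\<bar> \<le> (2 + K) * \<delta>" by blast
    qed
    then show ?thesis using ap x0 x\<rho> False by force
  qed
qed

text \<open>Summing \<open>card_Ax\<close> over fewer than \<open>\<rho>\<close> offsets cancels its
  denominator \<open>\<rho>\<close>. For the first solutions themselves,
  \<open>inverse_\<rho>_le\<close> converts 1 / \<rho> into \<delta>^m.\<close>

lemma card_A:
  "real (card A) \<le> (2 * 5 ^ CARD('d) + ((4 * (L + 2 + K) + 1) * (4 * c * (2 + K) + 3)) ^ CARD('m) * 3 ^ CARD('d))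
           * (real q ^ CARD('d) * \<delta> ^ CARD('m))"
proof -
  define C where "C = ((4 * (L + 2 + K) + 1) * (4 * c * (2 + K) + 3)) ^ CARD('m) * 3 ^ CARD('d)"
  have C: "C \<ge> 0" using K L c by (simp add: C_def)
  have fin: "finite A0" "finite (Ax x)" for x
    using finite_A by (auto simp: A0_def Ax_def)
  have "card A \<le> card (A0 \<union> (\<Union>x\<in>{1..<\<rho>}. (\<lambda>p. p(e := p e + x)) ` Ax x))"
    using fin by (intro card_mono A_cover) auto
  also have "\<dots> \<le> card A0 + card (\<Union>x\<in>{1..<\<rho>}. (\<lambda>p. p(e := p e + x)) ` Ax x)"
    by (rule card_Un_le)
  also have "card (\<Union>x\<in>{1..<\<rho>}. (\<lambda>p. p(e := p e + x)) ` Ax x) \<le> (\<Sum>x\<in>{1..<\<rho>}. card ((\<lambda>p. p(e := p e + x)) ` Ax x))"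
    by (rule card_UN_le) simp
  also have "\<dots> \<le> (\<Sum>x\<in>{1..<\<rho>}. card (Ax x))"
    by (intro sum_mono card_image_le fin)
  finally have "real (card A) \<le> real (card A0) + (\<Sum>x\<in>{1..<\<rho>}. real (card (Ax x)))"
    by (simp only: of_nat_sum[symmetric] of_nat_add[symmetric] of_nat_le_iff)
  also have "(\<Sum>x\<in>{1..<\<rho>}. real (card (Ax x))) \<le> real (card {1..<\<rho>}) * (C * real q ^ CARD('d) * \<delta> ^ CARD('m) / \<rho>)"
    by (rule sum_bounded_above) (use card_Ax in \<open>auto simp: C_def\<close>)
  also have "\<dots> \<le> real_of_int \<rho> * (C * real q ^ CARD('d) * \<delta> ^ CARD('m) / \<rho>)"
    using C \<delta> \<rho>_ge_1 by (intro mult_right_mono) auto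
  also have "\<dots> = C * (real q ^ CARD('d) * \<delta> ^ CARD('m))"
    using \<rho>_ge_1 by simp
  also have "real (card A0) \<le> 5 ^ CARD('d) * real q ^ CARD('d) * (1 / real_of_int \<rho>)"
    using card_A0 by simp
  also have "\<dots> \<le> 5 ^ CARD('d) * real q ^ CARD('d) * (2 * \<delta> ^ CARD('m))"
    by (intro mult_left_mono inverse_\<rho>_le) auto
  finally show ?thesis by (simp add: C_def algebra_simps)
qed

end

text \<open>The constant is uniform in the shifts \<mu> and \<gamma>; this matters because the shift
  of the grid will vary with \<open>q\<close>.\<close>

lemma near_points_bound:
  "\<exists>C\<ge>0. \<forall>q \<delta> \<mu> \<gamma>. q \<ge> 1 \<longrightarrow> 0 < \<delta> \<longrightarrow> \<delta> \<le> 1 \<longrightarrow> \<delta> ^ (2 * CARD('m) + 1) * real q \<ge> 1 \<longrightarrow>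
     finite (near_points B f q \<delta> \<mu> \<gamma>) \<and>
     real (card (near_points B f q \<delta> \<mu> \<gamma>)) \<le> C * (real q ^ CARD('d) * \<delta> ^ CARD('m))"
proof (intro exI[of _ "2 * 5 ^ CARD('d) + ((4 * (L + 2 + K) + 1) * (4 * c * (2 + K) + 3)) ^ CARD('m) * 3 ^ CARD('d)"] conjI allI impI)
  show "0 \<le> 2 * 5 ^ CARD('d) + ((4 * (L + 2 + K) + 1) * (4 * c * (2 + K) + 3)) ^ CARD('m) * 3 ^ CARD('d)"
    using K L c by simp
next
  fix q :: nat and \<delta> :: real and \<mu> \<gamma>
  assume *: "q \<ge> 1" "0 < \<delta>" "\<delta> \<le> 1" "\<delta> ^ (2 * CARD('m) + 1) * real q \<ge> 1"
  show "finite (near_points B f q \<delta> \<mu> \<gamma>)" by (rule finite_A[OF *])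
  show "real (card (near_points B f q \<delta> \<mu> \<gamma>)) \<le> (2 * 5 ^ CARD('d) + ((4 * (L + 2 + K) + 1) * (4 * c * (2 + K) + 3)) ^ CARD('m) * 3 ^ CARD('d)) * (real q ^ CARD('d) * \<delta> ^ CARD('m))"
    by (rule card_A[OF *])
qed

end

subsection \<open>Partial derivatives on the unit cube\<close>

lemma line_in_unit_cube_iff:
  assumes "x \<in> unit_cube"
  shows "x + t *\<^sub>R axis i 1 \<in> unit_cube \<longleftrightarrow> t \<in> {- x $ i..1 - x $ i}"
  using assms by (auto simp: mem_box_cart axis_def algebra_simps split: if_splits)

lemma line_set_unit_cube:
  "x \<in> unit_cube \<Longrightarrow> {t. x + t *\<^sub>R axis i 1 \<in> unit_cube} = {- x $ i..1 - x $ i}"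
  using line_in_unit_cube_iff by blast

text \<open>A coordinate line meets the cube in an interval of length 1, so 0 is a limit point even
  on a face and the relative derivatives are unique.\<close>

lemma line_limit_unit_cube:
  assumes "x \<in> unit_cube"
  shows "at 0 within {t. x + t *\<^sub>R axis i 1 \<in> unit_cube} \<noteq> bot"
  unfolding line_set_unit_cube[OF assms] using assms
  by (simp add: trivial_limit_within islimpt_Icc mem_box_cart)

lemma has_partial_derivative:
  assumes "partial_differentiable S i g x"
  shows "((\<lambda>t. g (x + t *\<^sub>R axis i 1)) has_vector_derivative partial_derivative S i g x)
           (at 0 within {t. x + t *\<^sub>R axis i 1 \<in> S})"
  using assms unfolding partial_differentiable_def partial_derivative_def vector_derivative_works by simp

lemma partial_derivativeI:
  assumes "x \<in> unit_cube"
    and "((\<lambda>t. g (x + t *\<^sub>R axis i 1)) has_vector_derivative D) (at 0 within {t. x + t *\<^sub>R axis i 1 \<in> unit_cube})"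
  shows "partial_differentiable unit_cube i g x" "partial_derivative unit_cube i g x = D"
proof -
  show "partial_differentiable unit_cube i g x"
    using assms(2) unfolding partial_differentiable_def
    by (rule differentiableI_vector)
  then show "partial_derivative unit_cube i g x = D"
    by (intro vector_derivative_unique_within[OF line_limit_unit_cube[OF assms(1)] has_partial_derivative assms(2)])
qed

text \<open>Agreement of \<open>g\<close> with the component is required on the cube only. This
  allows a second application to first partial derivatives, whose values are known only
  there.\<close>

lemma partial_derivative_component:
  fixes F :: "real ^ 'd \<Rightarrow> real ^ 'm"
  assumes "x \<in> unit_cube" "partial_differentiable unit_cube i F x" "\<And>y. y \<in> unit_cube \<Longrightarrow> g y = F y $ j"
  shows "partial_differentiable unit_cube i g x"
    "partial_derivative unit_cube i g x = partial_derivative unit_cube i F x $ j"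
proof -
  have "((\<lambda>t. F (x + t *\<^sub>R axis i 1) $ j) has_vector_derivative partial_derivative unit_cube i F x $ j)
           (at 0 within {t. x + t *\<^sub>R axis i 1 \<in> unit_cube})"
    by (rule bounded_linear.has_vector_derivative[OF bounded_linear_vec_nth has_partial_derivative[OF assms(2)]])
  then have "((\<lambda>t. g (x + t *\<^sub>R axis i 1)) has_vector_derivative partial_derivative unit_cube i F x $ j)
           (at 0 within {t. x + t *\<^sub>R axis i 1 \<in> unit_cube})"
    by (rule has_vector_derivative_transform[rotated 2]) (use assms in auto)
  from partial_derivativeI[OF assms(1) this]
  show "partial_differentiable unit_cube i g x"
    "partial_derivative unit_cube i g x = partial_derivative unit_cube i F x $ j" by auto
qed

lemma C2_partials_on_component:
  fixes F :: "real ^ 'd \<Rightarrow> real ^ 'm"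
  assumes "C2_partials_on unit_cube F"
  shows "C2_partials_on unit_cube (\<lambda>y. F y $ j)"
proof -
  have 1: "partial_differentiable unit_cube i F x" 
    "partial_differentiable unit_cube i (partial_derivative unit_cube k F) x" if "x \<in> unit_cube" for i k x
    using assms that by (auto simp: C2_partials_on_def)
  have c1: "partial_differentiable unit_cube i (\<lambda>y. F y $ j) x"
    "partial_derivative unit_cube i (\<lambda>y. F y $ j) x = partial_derivative unit_cube i F x $ j" if "x \<in> unit_cube" for i x
    by (rule partial_derivative_component[OF that 1(1)[OF that]], simp)+
  have c2: "partial_differentiable unit_cube i (partial_derivative unit_cube k (\<lambda>y. F y $ j)) x"
    "partial_derivative unit_cube i (partial_derivative unit_cube k (\<lambda>y. F y $ j)) x =
      partial_derivative unit_cube i (partial_derivative unit_cube k F) x $ j" if "x \<in> unit_cube" for i k x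
    by (rule partial_derivative_component[OF that 1(2)[OF that]], simp add: c1)+
  have "continuous_on unit_cube (\<lambda>x. partial_derivative unit_cube i F x $ j)"
     "continuous_on unit_cube (\<lambda>x. partial_derivative unit_cube i (partial_derivative unit_cube k F) x $ j)" for i k
    using assms by (auto simp: C2_partials_on_def intro!: continuous_intros)
  then show ?thesis unfolding C2_partials_on_def
    by (auto simp: c1 c2 cong: continuous_on_cong)
qed

text \<open>\<open>closed_segment\<close> treats increments of either sign together; the two cases
  reduce to the mean value theorem on an ordered interval.\<close>

lemma segment_mvt:
  fixes G :: "real \<Rightarrow> real"
  assumes "\<And>s. s \<in> closed_segment 0 k \<Longrightarrow> (G has_vector_derivative G' s) (at s within closed_segment 0 k)"
  shows "\<exists>s\<in>closed_segment 0 k. G k - G 0 = k * G' s"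
proof (cases "0 \<le> k")
  case True
  have "\<exists>s\<in>{0..k}. G k - G 0 = (\<lambda>h. h *\<^sub>R G' s) (k - 0)"
    by (rule mvt_very_simple[OF True]) (use assms True in \<open>auto simp: closed_segment_eq_real_ivl has_vector_derivative_def\<close>)
  then show ?thesis using True by (auto simp: closed_segment_eq_real_ivl)
next
  case False
  have "\<exists>s\<in>{k..0}. G 0 - G k = (\<lambda>h. h *\<^sub>R G' s) (0 - k)"
    by (rule mvt_very_simple) (use assms False in \<open>auto simp: closed_segment_eq_real_ivl has_vector_derivative_def\<close>)
  then show ?thesis using False by (force simp: closed_segment_eq_real_ivl algebra_simps)
qed

text \<open>Moving the base point along the line turns the derivative at parameter 0 into the one at
  \<open>t\<close>.\<close>

lemma line_has_vector_derivative:
  fixes g :: "real ^ 'd \<Rightarrow> real"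
  assumes diff: "\<And>x. x \<in> unit_cube \<Longrightarrow> partial_differentiable unit_cube i g x"
    and x: "x \<in> unit_cube" "x + t *\<^sub>R axis i 1 \<in> unit_cube" 
  shows "((\<lambda>t. g (x + t *\<^sub>R axis i 1)) has_vector_derivative partial_derivative unit_cube i g (x + t *\<^sub>R axis i 1))
    (at t within {s. x + s *\<^sub>R axis i 1 \<in> unit_cube})"
proof -
  define y where "y = x + t *\<^sub>R axis i 1"
  have eq: "y + (s - t) *\<^sub>R axis i 1 = x + s *\<^sub>R axis i 1" for s
    by (simp add: y_def algebra_simps)
  have im: "(\<lambda>s. s - t) ` {s. x + s *\<^sub>R axis i 1 \<in> unit_cube} = {s. y + s *\<^sub>R axis i 1 \<in> unit_cube}"
    by (auto simp: eq image_iff) (metis add_diff_cancel_right' eq)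
  have 1: "((\<lambda>s. s - t) has_vector_derivative 1) (at t within {s. x + s *\<^sub>R axis i 1 \<in> unit_cube})"
    by (auto intro!: derivative_eq_intros)
  have 2: "((\<lambda>s. g (y + s *\<^sub>R axis i 1)) has_vector_derivative partial_derivative unit_cube i g y)
        (at (t - t) within (\<lambda>s. s - t) ` {s. x + s *\<^sub>R axis i 1 \<in> unit_cube})"
    unfolding im using has_partial_derivative[OF diff[OF x(2)[folded y_def]]] by simp
  show ?thesis
    using vector_diff_chain_within[OF 1 2] unfolding o_def eq by (simp add: y_def)
qed

lemma closed_segment_line_subset:
  assumes "x \<in> cbox a b" "x + t *\<^sub>R axis i 1 \<in> cbox a b" "s \<in> closed_segment 0 t"
  shows "x + s *\<^sub>R axis i 1 \<in> cbox a b"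
proof -
  have "x + s *\<^sub>R axis i 1 \<in> closed_segment x (x + t *\<^sub>R axis i 1)"
    using assms(3) by (auto simp: in_segment algebra_simps)
  then show ?thesis
    using convex_contains_segment[of "cbox a b"] assms(1,2) by (meson convex_box(1) subsetD)
qed

lemma line_mvt:
  fixes g :: "real ^ 'd \<Rightarrow> real"
  assumes diff: "\<And>x. x \<in> unit_cube \<Longrightarrow> partial_differentiable unit_cube i g x"
    and x: "x \<in> unit_cube" "x + t *\<^sub>R axis i 1 \<in> unit_cube" 
  shows "\<exists>s\<in>closed_segment 0 t. g (x + t *\<^sub>R axis i 1) - g x = t * partial_derivative unit_cube i g (x + s *\<^sub>R axis i 1)"
proof -
  have "\<exists>s\<in>closed_segment 0 t. g (x + t *\<^sub>R axis i 1) - g (x + 0 *\<^sub>R axis i 1) = t * partial_derivative unit_cube i g (x + s *\<^sub>R axis i 1)"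
    by (rule segment_mvt, rule has_vector_derivative_within_subset, rule line_has_vector_derivative[OF diff])
       (use x closed_segment_line_subset[OF x] in auto)
  then show ?thesis by simp
qed

lemma bounded_on_unit_cube:
  fixes g :: "real ^ 'd \<Rightarrow> real"
  assumes "continuous_on unit_cube g"
  shows "\<exists>K\<ge>0. \<forall>x\<in>unit_cube. \<bar>g x\<bar> \<le> K"
proof -
  have "bounded (g ` unit_cube)"
    using assms compact_cbox compact_continuous_image compact_imp_bounded by blast
  then obtain K where "\<forall>x\<in>unit_cube. \<bar>g x\<bar> \<le> K" by (auto simp: bounded_iff)
  then show ?thesis by (intro exI[of _ "max K 0"]) auto
qed

text \<open>The mean value theorem is applied twice along the same line, with the second derivative
  bounded by compactness.\<close>

lemma C2_taylor:
  fixes g :: "real ^ 'd \<Rightarrow> real"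
  assumes g: "C2_partials_on unit_cube g"
  shows "\<exists>K\<ge>0. \<forall>z t. z \<in> unit_cube \<longrightarrow> z + t *\<^sub>R axis e 1 \<in> unit_cube \<longrightarrow>
    \<bar>g (z + t *\<^sub>R axis e 1) - g z - t * partial_derivative unit_cube e g z\<bar> \<le> K * t\<^sup>2"
proof -
  let ?D = "partial_derivative unit_cube e g"
  let ?DD = "partial_derivative unit_cube e ?D"
  obtain K where K: "K \<ge> 0" "\<And>x. x \<in> unit_cube \<Longrightarrow> \<bar>?DD x\<bar> \<le> K"
    using bounded_on_unit_cube[of ?DD] g unfolding C2_partials_on_def by blast
  show ?thesis
  proof (intro exI[of _ K] conjI allI impI K(1))
    fix z t assume z: "z \<in> unit_cube" "z + t *\<^sub>R axis e 1 \<in> unit_cube"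
    obtain s where s: "s \<in> closed_segment 0 t" "g (z + t *\<^sub>R axis e 1) - g z = t * ?D (z + s *\<^sub>R axis e 1)"
      using line_mvt[OF _ z, of g] g unfolding C2_partials_on_def by blast
    have zs: "z + s *\<^sub>R axis e 1 \<in> unit_cube" by (rule closed_segment_line_subset[OF z s(1)])
    obtain s' where s': "s' \<in> closed_segment 0 s" "?D (z + s *\<^sub>R axis e 1) - ?D z = s * ?DD (z + s' *\<^sub>R axis e 1)"
      using line_mvt[OF _ z(1) zs, of ?D] g unfolding C2_partials_on_def by blast
    have zs': "z + s' *\<^sub>R axis e 1 \<in> unit_cube" by (rule closed_segment_line_subset[OF z(1) zs s'(1)])
    have "g (z + t *\<^sub>R axis e 1) - g z - t * ?D z = t * (?D (z + s *\<^sub>R axis e 1) - ?D z)"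
      using s(2) by (simp add: right_diff_distrib)
    also have "\<dots> = t * s * ?DD (z + s' *\<^sub>R axis e 1)" using s'(2) by simp
    also have "\<bar>\<dots>\<bar> = \<bar>t\<bar> * \<bar>s\<bar> * \<bar>?DD (z + s' *\<^sub>R axis e 1)\<bar>" by (simp add: abs_mult)
    also have "\<dots> \<le> \<bar>t\<bar> * \<bar>t\<bar> * K"
      using s(1) K zs' by (intro mult_mono) (auto simp: closed_segment_eq_real_ivl split: if_splits)
    finally show "\<bar>g (z + t *\<^sub>R axis e 1) - g z - t * ?D z\<bar> \<le> K * t\<^sup>2"
      by (simp add: power2_eq_square mult_ac)
  qed
qed

section \<open>Increments of derivatives from second differences, and Lipschitz bounds\<close>

lemma vector_derivative_bound:
  fixes \<Phi> :: "real \<Rightarrow> real"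
  assumes "(\<Phi> has_vector_derivative D) (at 0 within T)" "at 0 within T \<noteq> bot"
    and "\<And>h. h \<in> T \<Longrightarrow> \<bar>\<Phi> h - \<Phi> 0\<bar> \<le> c * \<bar>h\<bar>"
  shows "\<bar>D\<bar> \<le> c"
proof -
  have "((\<lambda>h. (\<Phi> h - \<Phi> 0) / (h - 0)) \<longlongrightarrow> D) (at 0 within T)"
    using assms(1) unfolding has_real_derivative_iff_has_vector_derivative[symmetric] has_field_derivative_iff .
  moreover have "eventually (\<lambda>h. norm ((\<Phi> h - \<Phi> 0) / (h - 0)) \<le> c) (at 0 within T)"
    unfolding eventually_at_topological using assms(3) by (intro exI[of _ UNIV]) (auto simp: field_simps)
  ultimately have "norm D \<le> c" by (rule Lim_norm_ubound[OF assms(2)])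
  then show ?thesis by simp
qed

text \<open>The mixed derivative in the hypothesis differentiates along \<open>e\<close> last, whereas the first-order
  change of \<open>\<partial>\<^sub>e g\<close> along \<open>i\<close> is wanted. Estimating second differences instead of
  interchanging derivatives handles this without symmetry of second derivatives.\<close>

lemma partial_derivative_increment:
  fixes g :: "real ^ 'd \<Rightarrow> real"
  assumes g: "C2_partials_on unit_cube g" and V: "cbox a b \<subseteq> unit_cube" "\<And>i. a $ i < b $ i"
    and M: "\<And>y. y \<in> cbox a b \<Longrightarrow> \<bar>partial_derivative unit_cube e (partial_derivative unit_cube i g) y - M\<bar> \<le> \<epsilon>"
    and z: "z \<in> cbox a b" "z + k *\<^sub>R axis i 1 \<in> cbox a b"
  shows "\<bar>partial_derivative unit_cube e g (z + k *\<^sub>R axis i 1) - partial_derivative unit_cube e g z - k * M\<bar> \<le> \<epsilon> * \<bar>k\<bar>"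
proof (cases "i = e")
  case True
  let ?D = "partial_derivative unit_cube i g"
  have "z \<in> unit_cube" "z + k *\<^sub>R axis i 1 \<in> unit_cube" using z V by auto
  then obtain s where s: "s \<in> closed_segment 0 k" "?D (z + k *\<^sub>R axis i 1) - ?D z = k * partial_derivative unit_cube i ?D (z + s *\<^sub>R axis i 1)"
    using line_mvt[of i ?D z k] g unfolding C2_partials_on_def by blast
  have "?D (z + k *\<^sub>R axis i 1) - ?D z - k * M = k * (partial_derivative unit_cube i ?D (z + s *\<^sub>R axis i 1) - M)"
    using s(2) by (simp add: right_diff_distrib)
  also have "\<bar>\<dots>\<bar> \<le> \<bar>k\<bar> * \<epsilon>"
    unfolding abs_mult using M[OF closed_segment_line_subset[OF z s(1)]] True by (intro mult_left_mono) auto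
  finally show ?thesis using True by (simp add: mult.commute)
next
  case False
  define u where "u = z + k *\<^sub>R axis i 1"
  let ?T = "{h. z + h *\<^sub>R axis e 1 \<in> cbox a b}"
  let ?De = "partial_derivative unit_cube e g"
  let ?Di = "partial_derivative unit_cube i g"
  \<comment> \<open>The derivative of \<Phi> at 0 is the quantity to be bounded, so it suffices that
    \<Phi> h - \<Phi> 0 is at most \<epsilon> |k| |h| in absolute value.\<close>
  define \<Phi> where "\<Phi> h = g (u + h *\<^sub>R axis e 1) - g (z + h *\<^sub>R axis e 1) - h * (k * M)" for h
  have pd: "partial_differentiable unit_cube j g y" 
     "partial_differentiable unit_cube j (partial_derivative unit_cube j' g) y" if "y \<in> unit_cube" for j j' y
    using g that unfolding C2_partials_on_def by blast+
  \<comment> \<open>As \<open>i\<close> differs from \<open>e\<close>, the same steps along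
    \<open>e\<close> are admissible from \<open>z\<close> and from \<open>u\<close>.\<close>
  have T: "?T = {a $ e - z $ e..b $ e - z $ e}" "?T = {h. u + h *\<^sub>R axis e 1 \<in> cbox a b}"
    using z False by (auto simp: mem_box_cart axis_def u_def algebra_simps split: if_splits)
  have T0: "0 \<in> ?T" using z by simp
  have uU: "u \<in> unit_cube" "z \<in> unit_cube" using z V by (auto simp: u_def)
  have sub: "?T \<subseteq> {h. z + h *\<^sub>R axis e 1 \<in> unit_cube}" "?T \<subseteq> {h. u + h *\<^sub>R axis e 1 \<in> unit_cube}"
    using V T(2) by auto
  have "(\<Phi> has_vector_derivative ?De u - ?De z - 1 * (k * M)) (at 0 within ?T)"
    unfolding \<Phi>_def
  proof (intro has_vector_derivative_diff has_vector_derivative_mult_left has_vector_derivative_id)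
    show "((\<lambda>h. g (u + h *\<^sub>R axis e 1)) has_vector_derivative ?De u) (at 0 within ?T)"
      by (rule has_vector_derivative_within_subset[OF has_partial_derivative[OF pd(1)[OF uU(1)]] sub(2)])
    show "((\<lambda>h. g (z + h *\<^sub>R axis e 1)) has_vector_derivative ?De z) (at 0 within ?T)"
      by (rule has_vector_derivative_within_subset[OF has_partial_derivative[OF pd(1)[OF uU(2)]] sub(1)])
  qed
  moreover have "at 0 within ?T \<noteq> bot"
    using T0 V(2)[of e] unfolding T(1) by (simp add: trivial_limit_within islimpt_Icc)
  moreover have "\<bar>\<Phi> h - \<Phi> 0\<bar> \<le> (\<epsilon> * \<bar>k\<bar>) * \<bar>h\<bar>" if h: "h \<in> ?T" for h
  proof -
    define v where "v = z + h *\<^sub>R axis e 1"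
    have v: "v \<in> cbox a b" "v + k *\<^sub>R axis i 1 \<in> cbox a b"
      using h T(2) by (auto simp: v_def u_def algebra_simps)
    \<comment> \<open>The mean value theorem along \<open>i\<close> is applied to the difference of
      \<open>g\<close> on two parallel lines; a second one along \<open>e\<close> then meets the
      derivative in exactly the order controlled by \<open>M\<close>.\<close>
    have "\<exists>s\<in>closed_segment 0 k. (g (v + k *\<^sub>R axis i 1) - g (z + k *\<^sub>R axis i 1)) - (g (v + 0 *\<^sub>R axis i 1) - g (z + 0 *\<^sub>R axis i 1))
      = k * (?Di (v + s *\<^sub>R axis i 1) - ?Di (z + s *\<^sub>R axis i 1))"
    proof (rule segment_mvt, intro has_vector_derivative_diff)
      fix s assume s: "s \<in> closed_segment 0 k"
      show "((\<lambda>s. g (v + s *\<^sub>R axis i 1)) has_vector_derivative ?Di (v + s *\<^sub>R axis i 1)) (at s within closed_segment 0 k)"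
        using closed_segment_line_subset[OF v] v V s
        by (intro has_vector_derivative_within_subset[OF line_has_vector_derivative[OF pd(1)]]) auto
      show "((\<lambda>s. g (z + s *\<^sub>R axis i 1)) has_vector_derivative ?Di (z + s *\<^sub>R axis i 1)) (at s within closed_segment 0 k)"
        using closed_segment_line_subset[OF z] z V s
        by (intro has_vector_derivative_within_subset[OF line_has_vector_derivative[OF pd(1)]]) auto
    qed
    then obtain s where s: "s \<in> closed_segment 0 k"
      "g (v + k *\<^sub>R axis i 1) - g u - (g v - g z) = k * (?Di (v + s *\<^sub>R axis i 1) - ?Di (z + s *\<^sub>R axis i 1))"
      by (auto simp: u_def)
    define y where "y = z + s *\<^sub>R axis i 1"
    have y: "y \<in> cbox a b" "y + h *\<^sub>R axis e 1 \<in> cbox a b" "y + h *\<^sub>R axis e 1 = v + s *\<^sub>R axis i 1"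
      using closed_segment_line_subset[OF z s(1)] closed_segment_line_subset[OF v s(1)]
      by (auto simp: y_def v_def algebra_simps)
    obtain r where r: "r \<in> closed_segment 0 h"
      "?Di (y + h *\<^sub>R axis e 1) - ?Di y = h * partial_derivative unit_cube e ?Di (y + r *\<^sub>R axis e 1)"
      using line_mvt[of e ?Di y h] pd(2) y V by blast
    have "\<Phi> h - \<Phi> 0 = g (v + k *\<^sub>R axis i 1) - g u - (g v - g z) - h * (k * M)"
      by (simp add: \<Phi>_def v_def u_def algebra_simps)
    also have "\<dots> = h * k * (partial_derivative unit_cube e ?Di (y + r *\<^sub>R axis e 1) - M)"
      using s(2) r(2) unfolding y(3) y_def[symmetric] by (simp add: right_diff_distrib)
    also have "\<bar>\<dots>\<bar> \<le> \<bar>h * k\<bar> * \<epsilon>"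
      unfolding abs_mult[of "h * k"] using M[OF closed_segment_line_subset[OF y(1,2) r(1)]] by (intro mult_left_mono) auto
    finally show ?thesis by (simp add: abs_mult mult_ac)
  qed
  ultimately have "\<bar>?De u - ?De z - 1 * (k * M)\<bar> \<le> \<epsilon> * \<bar>k\<bar>" by (rule vector_derivative_bound)
  then show ?thesis by (simp add: u_def)
qed

text \<open>Coordinates are changed from \<open>x\<close> to \<open>y\<close> one at a time. Every
  intermediate point takes each coordinate from one of the two, so the path stays in the
  box.\<close>

lemma coordinatewise_increment:
  fixes g :: "real ^ 'd \<Rightarrow> real"
  assumes step: "\<And>z k i. i \<in> I \<Longrightarrow> z \<in> cbox a b \<Longrightarrow> z + k *\<^sub>R axis i 1 \<in> cbox a b \<Longrightarrow>
      \<bar>g (z + k *\<^sub>R axis i 1) - g z - k * c i\<bar> \<le> \<epsilon> * \<bar>k\<bar>"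
    and "x \<in> cbox a b" "y \<in> cbox a b" "\<And>i. i \<notin> I \<Longrightarrow> x $ i = y $ i"
  shows "\<bar>g y - g x - (\<Sum>i\<in>I. (y $ i - x $ i) * c i)\<bar> \<le> \<epsilon> * (\<Sum>i\<in>I. \<bar>y $ i - x $ i\<bar>)"
  using finite[of I] assms
proof (induction I arbitrary: x rule: finite_induct)
  case empty
  then have "x = y" by (simp add: vec_eq_iff)
  then show ?case by simp
next
  case (insert i I)
  define k where "k = y $ i - x $ i"
  define x' where "x' = x + k *\<^sub>R axis i 1"
  have x'i: "x' $ j = (if j = i then y $ i else x $ j)" for j by (simp add: x'_def k_def axis_def)
  have x': "x' \<in> cbox a b" using insert.prems(2,3) by (auto simp: mem_box_cart x'i)
  have IH: "\<bar>g y - g x' - (\<Sum>j\<in>I. (y $ j - x' $ j) * c j)\<bar> \<le> \<epsilon> * (\<Sum>j\<in>I. \<bar>y $ j - x' $ j\<bar>)"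
    by (rule insert.IH) (use insert.prems x' in \<open>auto simp: x'i\<close>)
  have eq: "(\<Sum>j\<in>I. (y $ j - x' $ j) * c j) = (\<Sum>j\<in>I. (y $ j - x $ j) * c j)"
    "(\<Sum>j\<in>I. \<bar>y $ j - x' $ j\<bar>) = (\<Sum>j\<in>I. \<bar>y $ j - x $ j\<bar>)"
    using insert.hyps by (auto simp: x'i intro!: sum.cong)
  have "\<bar>g x' - g x - k * c i\<bar> \<le> \<epsilon> * \<bar>k\<bar>"
    unfolding x'_def using insert.prems x' by (intro insert.prems(1)) (auto simp: x'_def)
  then show ?case using IH insert.hyps unfolding eq
    by (simp add: distrib_left k_def[symmetric])
qed

text \<open>The first partial derivatives are bounded by compactness, and
  \<open>coordinatewise_increment\<close> with zero slopes turns this into a Lipschitz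
  bound.\<close>

lemma C2_lipschitz:
  fixes f :: "real ^ 'd \<Rightarrow> real ^ 'm"
  assumes f: "C2_partials_on unit_cube f"
  shows "\<exists>L>0. \<forall>x\<in>unit_cube. \<forall>y\<in>unit_cube. norm (f x - f y) \<le> L * norm (x - y)"
proof -
  have "\<exists>L\<ge>0. \<forall>x\<in>unit_cube. \<bar>partial_derivative unit_cube i (\<lambda>y. f y $ j) x\<bar> \<le> L" for i j
    using C2_partials_on_component[OF f, of j] unfolding C2_partials_on_def
    by (intro bounded_on_unit_cube) blast
  then obtain L where L: "\<And>i j. L i j \<ge> 0"
      "\<And>i j x. x \<in> unit_cube \<Longrightarrow> \<bar>partial_derivative unit_cube i (\<lambda>y. f y $ j) x\<bar> \<le> L i j"
    by metis
  define N where "N = (\<Sum>i\<in>UNIV. \<Sum>j\<in>UNIV. L i j)"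
  have N: "L i j \<le> N" for i j
  proof -
    have "L i j \<le> (\<Sum>j\<in>UNIV. L i j)" using L by (intro member_le_sum) auto
    also have "\<dots> \<le> N" unfolding N_def using L by (intro member_le_sum[of i UNIV "\<lambda>i. \<Sum>j\<in>UNIV. L i j"] sum_nonneg) auto
    finally show ?thesis .
  qed
  have N0: "N \<ge> 0" using L N by (meson order_trans)
  have comp: "\<bar>f y $ j - f x $ j\<bar> \<le> N * (CARD('d) * norm (x - y))" if xy: "x \<in> unit_cube" "y \<in> unit_cube" for x y j
  proof -
    have pd: "partial_differentiable unit_cube i (\<lambda>y. f y $ j) z" if "z \<in> unit_cube" for i z
      using C2_partials_on_component[OF f, of j] that unfolding C2_partials_on_def by blast
    have "\<bar>f y $ j - f x $ j - (\<Sum>i\<in>UNIV. (y $ i - x $ i) * 0)\<bar> \<le> N * (\<Sum>i\<in>UNIV. \<bar>y $ i - x $ i\<bar>)"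
    proof (rule coordinatewise_increment[of UNIV 0 1 "\<lambda>y. f y $ j"])
      fix z :: "real ^ 'd" and k i assume z: "z \<in> unit_cube" "z + k *\<^sub>R axis i 1 \<in> unit_cube"
      obtain s where s: "s\<in>closed_segment 0 k" 
        "f (z + k *\<^sub>R axis i 1) $ j - f z $ j = k * partial_derivative unit_cube i (\<lambda>y. f y $ j) (z + s *\<^sub>R axis i 1)"
        using line_mvt[OF pd z] by blast
      have "\<bar>f (z + k *\<^sub>R axis i 1) $ j - f z $ j\<bar> \<le> \<bar>k\<bar> * N"
        unfolding s(2) abs_mult using L(2)[OF closed_segment_line_subset[OF z s(1)], of i j] N[of i j] by (intro mult_left_mono) auto
      then show "\<bar>f (z + k *\<^sub>R axis i 1) $ j - f z $ j - k * 0\<bar> \<le> N * \<bar>k\<bar>" by (simp add: mult.commute)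
    qed (use xy in auto)
    also have "\<dots> \<le> N * (CARD('d) * norm (x - y))"
    proof (intro mult_left_mono N0)
      have "\<bar>y $ i - x $ i\<bar> \<le> norm (x - y)" for i
        using component_le_norm_cart[of "x - y" i] by (simp add: abs_minus_commute)
      then show "(\<Sum>i\<in>UNIV. \<bar>y $ i - x $ i\<bar>) \<le> CARD('d) * norm (x - y)"
        using sum_bounded_above[of UNIV "\<lambda>i. \<bar>y $ i - x $ i\<bar>" "norm (x - y)"] by simp
    qed
    finally show ?thesis by simp
  qed
  show ?thesis
  proof (intro exI[of _ "CARD('m) * (N * CARD('d)) + 1"] conjI ballI)
    fix x y :: "real ^ 'd" assume xy: "x \<in> unit_cube" "y \<in> unit_cube"
    have "norm (f x - f y) \<le> (\<Sum>j\<in>UNIV. \<bar>(f x - f y) $ j\<bar>)" by (rule norm_le_l1_cart)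
    also have "\<dots> \<le> of_nat (card (UNIV :: 'm set)) * (N * (CARD('d) * norm (x - y)))"
      by (rule sum_bounded_above) (use comp[OF xy] in \<open>simp add: abs_minus_commute\<close>)
    finally show "norm (f x - f y) \<le> (CARD('m) * (N * CARD('d)) + 1) * norm (x - y)"
      by (simp add: algebra_simps) (smt (verit) norm_ge_zero)
  qed (use N0 in \<open>auto intro!: add_nonneg_pos\<close>)
qed

section \<open>Numbering of the index types\<close>

lemma index_pos_le: "index_pos (i :: 'm::{finite,linorder}) \<in> {1..CARD('m)}"
  unfolding index_pos_def by (auto simp: card_mono Suc_le_eq card_gt_0_iff)

lemma inj_index_pos: "inj (index_pos :: 'm::{finite,linorder} \<Rightarrow> nat)"
proof (rule linorder_injI)
  fix x y :: 'm assume "x < y"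
  then have "{..x} \<subset> {..y}" by auto
  then show "index_pos x \<noteq> index_pos y"
    unfolding index_pos_def by (metis finite less_irrefl psubset_card_mono)
qed

lemma inj_on_nth_index: "inj_on (nth_index :: nat \<Rightarrow> 'd::{finite,linorder}) {1..CARD('d)}"
proof (rule inj_onI)
  fix x y assume xy: "x \<in> {1..CARD('d)}" "y \<in> {1..CARD('d)}" "(nth_index x :: 'd) = nth_index y"
  then have "x - 1 = y - 1"
    unfolding nth_index_def
    by (subst (asm) nth_eq_iff_index_eq) auto
  then show "x = y" using xy(1,2) by auto
qed

text \<open>This provides the embedding of the component indices as the first coordinates.\<close>

lemma inj_nth_index_index_pos:
  assumes "CARD('m::{finite,linorder}) \<le> CARD('d::{finite,linorder})"
  shows "inj (\<lambda>i::'m. nth_index (index_pos i) :: 'd)"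
proof (rule injI)
  fix x y :: 'm assume "(nth_index (index_pos x) :: 'd) = nth_index (index_pos y)"
  moreover have "index_pos x \<in> {1..CARD('d)}" "index_pos y \<in> {1..CARD('d)}"
    using index_pos_le[of x] index_pos_le[of y] assms by auto
  ultimately have "index_pos x = index_pos y" using inj_on_nth_index[THEN inj_onD] by blast
  then show "x = y" by (rule injD[OF inj_index_pos])
qed

text \<open>This places the distinguished first coordinate in the range of that embedding.\<close>

lemma index_pos_Min: "index_pos (Min UNIV :: 'm::{finite,linorder}) = 1"
proof -
  have "{..Min UNIV :: 'm} = {Min UNIV}" by (auto intro: antisym)
  then show ?thesis by (simp add: index_pos_def)
qed

subsection \<open>Null sets near points with invertible mixed Hessian\<close>

text \<open>On a small box around \<open>p\<close> the mixed Hessian is almost constant, so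
  increments of \<open>w\<close> are a fixed invertible linear map of the increments of the first m
  coordinates, up to a small relative error. This gives the separation required by
  \<open>near_points_bound\<close>.\<close>

lemma local_near_points_bound:
  fixes f :: "real ^ 'd::{finite,linorder} \<Rightarrow> real ^ 'm::{finite,linorder}"
  assumes f: "C2_partials_on unit_cube f" and md: "CARD('m) \<le> CARD('d)"
    and p: "p \<in> unit_cube" and det: "det (mixed_hessian unit_cube f p) \<noteq> 0"
  shows "\<exists>r>0. \<exists>C\<ge>0. \<forall>q \<delta> \<mu> \<gamma>. q \<ge> 1 \<longrightarrow> 0 < \<delta> \<longrightarrow> \<delta> \<le> 1 \<longrightarrow> \<delta> ^ (2 * CARD('m) + 1) * real q \<ge> 1 \<longrightarrow>
     finite (near_points (cbox (\<chi> i. max 0 (p $ i - r)) (\<chi> i. min 1 (p $ i + r))) f q \<delta> \<mu> \<gamma>) \<and>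
     real (card (near_points (cbox (\<chi> i. max 0 (p $ i - r)) (\<chi> i. min 1 (p $ i + r))) f q \<delta> \<mu> \<gamma>))
       \<le> C * (real q ^ CARD('d) * \<delta> ^ CARD('m))"
proof -
  define \<iota> where "\<iota> i = (nth_index (index_pos i) :: 'd)" for i :: 'm
  define e where "e = (nth_index 1 :: 'd)"
  define w where "w z = (\<chi> j. partial_derivative unit_cube e (\<lambda>y. f y $ j) z)" for z
  define M where "M = mixed_hessian unit_cube f p"
  have inj: "inj \<iota>" unfolding \<iota>_def by (rule inj_nth_index_index_pos[OF md])
  have e: "e \<in> range \<iota>"
  proof -
    have "e = \<iota> (Min UNIV)" by (simp add: e_def \<iota>_def index_pos_Min)
    then show ?thesis by blast
  qed
  have fj: "C2_partials_on unit_cube (\<lambda>y. f y $ j)" for j by (rule C2_partials_on_component[OF f])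
  have mh: "mixed_hessian unit_cube f x $ i $ j =
      partial_derivative unit_cube e (partial_derivative unit_cube (\<iota> i) (\<lambda>y. f y $ j)) x" for x i j
    by (simp add: mixed_hessian_def e_def \<iota>_def)
  have cont: "continuous_on unit_cube (mixed_hessian unit_cube f)"
    unfolding mixed_hessian_def by (intro continuous_on_vec_lambda) (use fj in \<open>simp add: C2_partials_on_def\<close>)
  \<comment> \<open>Rows of the mixed Hessian belong to coordinates and columns to components of
    \<open>f\<close>, so the transpose acts on coordinate increments.\<close>
  have "invertible (transpose M)" using det by (simp add: M_def invertible_det_nz)
  then have "inj ((*v) (transpose M))" by (simp add: inj_matrix_vector_mult)
  then obtain b where b: "b > 0" "\<And>u. b * norm u \<le> norm (transpose M *v u)"
    using linear_inj_bounded_below_pos[OF matrix_vector_mul_linear] by blast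
  define m where "m = real CARD('m)"
  have m: "m > 0" by (simp add: m_def)
  \<comment> \<open>Passing from components to the norm and summing increments each cost a factor
    \<open>m\<close>, so the total error is half of the lower bound
    \<open>b * norm u\<close>.\<close>
  define \<epsilon> where "\<epsilon> = b / (2 * m\<^sup>2)"
  have \<epsilon>: "\<epsilon> > 0" using b m by (simp add: \<epsilon>_def)
  obtain D where D: "D > 0" "\<And>y. y \<in> unit_cube \<Longrightarrow> dist y p < D \<Longrightarrow> dist (mixed_hessian unit_cube f y) M < \<epsilon>"
    using cont p \<epsilon> unfolding continuous_on_iff M_def by metis
  define r where "r = D / (2 * CARD('d))"
  have r: "r > 0" using D by (simp add: r_def)
  define lo :: "real ^ 'd::{finite,linorder}" where "lo = (\<chi> i. max 0 (p $ i - r))"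
  define hi :: "real ^ 'd::{finite,linorder}" where "hi = (\<chi> i. min 1 (p $ i + r))"
  have p': "0 \<le> p $ i" "p $ i \<le> 1" for i using p by (auto simp: mem_box_cart)
  have V: "cbox lo hi \<subseteq> unit_cube"
    by (auto simp: mem_box_cart lo_def hi_def) 
  \<comment> \<open>Cutting the box to the cube leaves it nondegenerate even if \<open>p\<close>
    lies on a face.\<close>
  have V': "lo $ i < hi $ i" for i
    using p'[of i] r by (auto simp: lo_def hi_def)
  have close: "\<bar>mixed_hessian unit_cube f y $ i $ j - M $ i $ j\<bar> \<le> \<epsilon>" if y: "y \<in> cbox lo hi" for y i j
  proof -
    have "\<bar>(y - p) $ i\<bar> \<le> r" for i
    proof -
      have "lo $ i \<le> y $ i" "y $ i \<le> hi $ i" using y by (auto simp: mem_box_cart)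
      then show ?thesis by (simp add: lo_def hi_def abs_le_iff algebra_simps)
    qed
    then have "norm (y - p) \<le> of_nat (card (UNIV :: 'd set)) * r"
      by (intro order_trans[OF norm_le_l1_cart] sum_bounded_above) auto
    also have "\<dots> < D" using D(1) by (simp add: r_def)
    finally have "norm (mixed_hessian unit_cube f y - M) < \<epsilon>"
      using D(2)[of y] y V by (auto simp: dist_norm)
    moreover have "\<bar>(mixed_hessian unit_cube f y - M) $ i $ j\<bar> \<le> norm (mixed_hessian unit_cube f y - M)"
      by (metis Finite_Cartesian_Product.norm_nth_le order_trans real_norm_def)
    ultimately show ?thesis by simp
  qed
  have "\<exists>K\<ge>0. \<forall>z t. z \<in> unit_cube \<longrightarrow> z + t *\<^sub>R axis e 1 \<in> unit_cube \<longrightarrow>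
      \<bar>f (z + t *\<^sub>R axis e 1) $ j - f z $ j - t * w z $ j\<bar> \<le> K * t\<^sup>2" for j
    using C2_taylor[OF fj[of j], of e] by (simp add: w_def)
  then obtain K where K: "\<And>j. K j \<ge> 0" "\<And>j z t. z \<in> unit_cube \<Longrightarrow> z + t *\<^sub>R axis e 1 \<in> unit_cube \<Longrightarrow>
      \<bar>f (z + t *\<^sub>R axis e 1) $ j - f z $ j - t * w z $ j\<bar> \<le> K j * t\<^sup>2"
    by metis
  have "\<exists>L\<ge>0. \<forall>z\<in>unit_cube. \<bar>w z $ j\<bar> \<le> L" for j
    using bounded_on_unit_cube[of "partial_derivative unit_cube e (\<lambda>y. f y $ j)"] fj[of j]
    unfolding C2_partials_on_def w_def by simp
  then obtain L where L: "\<And>j. L j \<ge> 0" "\<And>j z. z \<in> unit_cube \<Longrightarrow> \<bar>w z $ j\<bar> \<le> L j"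
    by metis
  have Kle: "K j \<le> sum K UNIV" and Lle: "L j \<le> sum L UNIV" for j
    using K L by (auto intro!: member_le_sum)
  have sep: "\<bar>z $ i - z' $ i\<bar> \<le> 2 * m / b * t"
    if z: "z \<in> cbox lo hi" "z' \<in> cbox lo hi" and off: "\<And>i. i \<notin> range \<iota> \<Longrightarrow> z $ i = z' $ i"
      and wz: "\<And>j. \<bar>w z $ j - w z' $ j\<bar> \<le> t" for z z' i t
  proof -
    define u :: "real ^ 'm::{finite,linorder}" where "u = (\<chi> k. z' $ \<iota> k - z $ \<iota> k)"
    have t0: "t \<ge> 0" using wz by (meson abs_ge_zero order_trans)
    have "\<bar>(transpose M *v u) $ j\<bar> \<le> t + \<epsilon> * (m * norm u)" for j
    proof -
      have "\<bar>w z' $ j - w z $ j - (\<Sum>i\<in>range \<iota>. (z' $ i - z $ i) * M $ (inv \<iota> i) $ j)\<bar>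
          \<le> \<epsilon> * (\<Sum>i\<in>range \<iota>. \<bar>z' $ i - z $ i\<bar>)"
      proof (rule coordinatewise_increment[OF _ z off])
        fix y k i assume i: "i \<in> range \<iota>" and y: "y \<in> cbox lo hi" "y + k *\<^sub>R axis i 1 \<in> cbox lo hi"
        from i obtain l where l: "i = \<iota> l" by blast
        show "\<bar>w (y + k *\<^sub>R axis i 1) $ j - w y $ j - k * M $ (inv \<iota> i) $ j\<bar> \<le> \<epsilon> * \<bar>k\<bar>"
          unfolding w_def l inv_f_f[OF inj] vec_lambda_beta
          by (rule partial_derivative_increment[OF fj V V']) (use close y l in \<open>auto simp: mh\<close>)
      qed
      then have "\<bar>w z' $ j - w z $ j - (\<Sum>k\<in>UNIV. u $ k * M $ k $ j)\<bar> \<le> \<epsilon> * (\<Sum>k\<in>UNIV. \<bar>u $ k\<bar>)"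
        by (simp add: sum.reindex[OF inj] inv_f_f[OF inj] u_def)
      moreover have "(transpose M *v u) $ j = (\<Sum>k\<in>UNIV. u $ k * M $ k $ j)"
        by (simp add: matrix_vector_mult_def transpose_def mult.commute)
      moreover have "\<epsilon> * (\<Sum>k\<in>UNIV. \<bar>u $ k\<bar>) \<le> \<epsilon> * (m * norm u)"
        using sum_bounded_above[of UNIV "\<lambda>k. \<bar>u $ k\<bar>" "norm u"] component_le_norm_cart[of u] \<epsilon>
        by (intro mult_left_mono) (auto simp: m_def)
      ultimately show ?thesis using wz[of j] by linarith
    qed
    then have "norm (transpose M *v u) \<le> of_nat (card (UNIV :: 'm set)) * (t + \<epsilon> * (m * norm u))"
      by (intro order_trans[OF norm_le_l1_cart] sum_bounded_above) auto
    also have "\<dots> = m * t + b / 2 * norm u"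
      using m by (simp add: \<epsilon>_def m_def[symmetric] power2_eq_square field_simps)
    finally have "b / 2 * norm u \<le> m * t" using b(2)[of u] by linarith
    then have nu: "norm u \<le> 2 * m / b * t" using b(1) by (simp add: field_simps)
    show ?thesis
    proof (cases "i \<in> range \<iota>")
      case True
      then obtain l where "i = \<iota> l" by blast
      then have "\<bar>z $ i - z' $ i\<bar> = \<bar>u $ l\<bar>" by (simp add: u_def abs_minus_commute)
      also have "\<dots> \<le> norm u" by (rule component_le_norm_cart)
      finally show ?thesis using nu by simp
    qed (use off t0 b m in simp)
  qed
  have "\<exists>C\<ge>0. \<forall>q \<delta> \<mu> \<gamma>. q \<ge> 1 \<longrightarrow> 0 < \<delta> \<longrightarrow> \<delta> \<le> 1 \<longrightarrow> \<delta> ^ (2 * CARD('m) + 1) * real q \<ge> 1 \<longrightarrow>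
     finite (near_points (cbox lo hi) f q \<delta> \<mu> \<gamma>) \<and>
     real (card (near_points (cbox lo hi) f q \<delta> \<mu> \<gamma>)) \<le> C * (real q ^ CARD('d) * \<delta> ^ CARD('m))"
  proof (rule near_points_bound[OF inj e V, where K = "sum K UNIV" and L = "sum L UNIV" and c = "2 * m / b" and w = w])
    show "0 \<le> sum K UNIV" "0 \<le> sum L UNIV" "0 \<le> 2 * m / b"
      using K L b m by (auto intro!: sum_nonneg)
    fix z t j assume z: "z \<in> cbox lo hi"
    then show "\<bar>w z $ j\<bar> \<le> sum L UNIV" using L(2)[of z j] Lle[of j] V by fastforce
    assume "z + t *\<^sub>R axis e 1 \<in> cbox lo hi"
    then have "\<bar>f (z + t *\<^sub>R axis e 1) $ j - f z $ j - t * w z $ j\<bar> \<le> K j * t\<^sup>2"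
      using K(2) z V by blast
    also have "\<dots> \<le> sum K UNIV * t\<^sup>2" using Kle by (intro mult_right_mono) auto
    finally show "\<bar>f (z + t *\<^sub>R axis e 1) $ j - f z $ j - t * w z $ j\<bar> \<le> sum K UNIV * t\<^sup>2" .
  qed (rule sep)
  then show ?thesis using r unfolding lo_def hi_def by blast
qed

section \<open>From approximable points to grid points, and local nullity of the graph\<close>

lemma dist_to_int_le_vec:
  "b \<in> Basis \<Longrightarrow> dist_to_int (x \<bullet> b) \<le> dist_to_int_vec x"
  unfolding dist_to_int_vec_def by (intro Max_ge) auto

lemma dist_to_int_vec_prod_less:
  fixes x :: "(real ^ 'd) \<times> (real ^ 'm)"
  assumes "dist_to_int_vec x < t"
  shows "\<bar>fst x $ i - of_int (round (fst x $ i))\<bar> < t" "\<bar>snd x $ j - of_int (round (snd x $ j))\<bar> < t"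
proof -
  have "dist_to_int (x \<bullet> (axis i 1, 0)) \<le> dist_to_int_vec x"
    by (rule dist_to_int_le_vec) (simp add: Basis_prod_def rev_image_eqI)
  moreover have "dist_to_int (x \<bullet> (0, axis j 1)) \<le> dist_to_int_vec x"
    by (rule dist_to_int_le_vec) (simp add: Basis_prod_def rev_image_eqI)
  ultimately have "dist_to_int (x \<bullet> (axis i 1, 0)) < t" "dist_to_int (x \<bullet> (0, axis j 1)) < t"
    using assms by linarith+
  then show "\<bar>fst x $ i - of_int (round (fst x $ i))\<bar> < t" "\<bar>snd x $ j - of_int (round (snd x $ j))\<bar> < t"
    by (auto simp: dist_to_int_def inner_prod_def inner_axis)
qed

text \<open>As q \<ge> 3 > exp 1, the logarithmic factor is at least 1; raising q^(-1/(2m+1)) to the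
  power 2m + 1 gives 1 / q.\<close>

lemma psi_power_ge:
  fixes \<psi> q :: real and m :: nat
  assumes q: "q \<ge> 3" and \<psi>: "\<psi> \<ge> q powr (- 1 / (2 * real m + 1)) * ln q powr (2 / (2 * real m + 1))"
  shows "\<psi> ^ (2 * m + 1) * q \<ge> 1"
proof -
  have "exp 1 \<le> q" using exp_le q by linarith
  then have "ln q \<ge> 1" using q by (simp add: ln_ge_iff)
  then have "ln q powr (2 / (2 * real m + 1)) \<ge> 1" by (intro ge_one_powr_ge_zero) auto
  then have "q powr (- 1 / (2 * real m + 1)) * 1 \<le> q powr (- 1 / (2 * real m + 1)) * ln q powr (2 / (2 * real m + 1))"
    by (intro mult_left_mono) auto
  then have "q powr (- 1 / (2 * real m + 1)) \<le> \<psi>" using \<psi> by simp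
  then have "(q powr (- 1 / (2 * real m + 1))) ^ (2 * m + 1) \<le> \<psi> ^ (2 * m + 1)" by (intro power_mono) auto
  also have "(q powr (- 1 / (2 * real m + 1))) ^ (2 * m + 1) = q powr (- 1 / (2 * real m + 1) * real (2 * m + 1))"
    using q by (subst powr_power) (auto simp: mult.commute)
  also have "- 1 / (2 * real m + 1) * real (2 * m + 1) = - 1"
    by (simp add: field_simps)
  finally have "1 / q \<le> \<psi> ^ (2 * m + 1)" using q by (simp add: powr_minus_divide)
  then show ?thesis using q by (simp add: field_simps)
qed

text \<open>Over a neighbourhood of \<open>p\<close>, each approximable point lies for infinitely
  many \<open>q\<close> in a piece of the graph of diameter O(\<psi>(q) / q) attached to a near
  point. The local count makes the total cost a constant multiple of the given series.\<close>

lemma local_graph_null: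
  fixes f :: "real ^ 'd::{finite,linorder} \<Rightarrow> real ^ 'm::{finite,linorder}"
    and \<theta> :: "(real ^ 'd::{finite,linorder}) \<times> (real ^ 'm::{finite,linorder})"
    and \<psi> :: "real \<Rightarrow> real"
  assumes f: "C2_partials_on unit_cube f" and md: "CARD('m) \<le> CARD('d)"
    and \<psi>0: "\<And>r. r \<ge> 0 \<Longrightarrow> \<psi> r \<ge> 0" and \<psi>lim: "(\<psi> \<longlongrightarrow> 0) at_top"
    and \<psi>: "\<And>q::nat. q \<ge> 1 \<Longrightarrow> \<psi> (real q) > 0 \<Longrightarrow> 
           \<psi> (real q) \<ge> real q powr (- 1 / (2 * real CARD('m) + 1)) * ln (real q) powr (2 / (2 * real CARD('m) + 1))"
    and s: "0 < s"
    and sum: "summable (\<lambda>q. (\<psi> (real q) / real q) powr (s + real CARD('m)) * real q ^ (CARD('m) + CARD('d)))"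
    and p: "p \<in> unit_cube" and det: "det (mixed_hessian unit_cube f p) \<noteq> 0"
  shows "\<exists>W. open W \<and> p \<in> W \<and> hausdorff_measure s ((\<lambda>x. (x, f x)) ` (unit_cube \<inter> W) \<inter> approximable \<psi> \<theta>) = 0"
proof -
  define m where "m = CARD('m)"
  define d where "d = CARD('d)"
  obtain r C where r: "r > 0" and C: "C \<ge> 0"
    and count: "\<And>q \<delta> \<mu> \<gamma>. q \<ge> 1 \<Longrightarrow> 0 < \<delta> \<Longrightarrow> \<delta> \<le> 1 \<Longrightarrow> \<delta> ^ (2 * m + 1) * real q \<ge> 1 \<Longrightarrow>
     finite (near_points (cbox (\<chi> i. max 0 (p $ i - r)) (\<chi> i. min 1 (p $ i + r))) f q \<delta> \<mu> \<gamma>) \<and>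
     real (card (near_points (cbox (\<chi> i. max 0 (p $ i - r)) (\<chi> i. min 1 (p $ i + r))) f q \<delta> \<mu> \<gamma>))
       \<le> C * (real q ^ d * \<delta> ^ m)"
    unfolding m_def d_def using local_near_points_bound[OF f md p det] by blast
  define V where "V = cbox (\<chi> i. max 0 (p $ i - r)) (\<chi> i. min 1 (p $ i + r))"
  note count = count[folded V_def]
  obtain L where L: "L > 0" "\<And>x y. x \<in> unit_cube \<Longrightarrow> y \<in> unit_cube \<Longrightarrow> norm (f x - f y) \<le> L * norm (x - y)"
    using C2_lipschitz[OF f] by blast
  \<comment> \<open>A point of \<open>W\<close> moved inward by at most \<open>h\<close> stays
    within 2 h \<le> r of \<open>p\<close> in each coordinate and cannot cross the opposite
    face.\<close>
  define h where "h = min (r / 2) (1 / 4)"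
  have h: "h > 0" "2 * h \<le> r" "2 * h \<le> 1 / 2" using r by (auto simp: h_def)
  define W where "W = box (\<chi> i. p $ i - h) (\<chi> i. p $ i + h)"
  have W: "open W" "p \<in> W" using h by (auto simp: W_def mem_box_cart)
  \<comment> \<open>One \<psi>(q) comes from the approximation itself, and 2 L d \<psi>(q) from
    replacing the point by a grid point within \<open>rad q\<close>.\<close>
  define C1 where "C1 = 1 + 2 * L * d"
  have C1: "C1 \<ge> 1" using L by (simp add: C1_def)
  \<comment> \<open>The grid is shifted by \<open>\<psi>(q)\<close> towards the inside of the cube, so that the grid point chosen
    near \<open>x\<close> lies in the cube, where \<open>f\<close> is controlled.\<close>
  define \<sigma> where "\<sigma> i = (if p $ i \<le> 1 / 2 then 1 else - 1 :: real)" for i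
  define \<mu> where "\<mu> q = (\<chi> i. fst \<theta> $ i + \<sigma> i * \<psi> (real q))" for q :: nat
  \<comment> \<open>A denominator with \<psi>(q) = 0 approximates no point, while the count requires
    positive \<delta>.\<close>
  define I where "I q = (if \<psi> (real q) = 0 then {} else near_points V f q (C1 * \<psi> (real q)) (\<mu> q) (snd \<theta>))" for q
  define rad where "rad q = d * (2 * \<psi> (real q) / real q)" for q :: nat
  define G where "G q a = (\<lambda>x. (x, f x)) ` {x \<in> unit_cube. norm (x - grid_point q (\<mu> q) a) \<le> rad q}" for q a
  define R where "R = (1 + L) * (4 * d)"
  have R: "R > 0" using L by (simp add: R_def d_def)
  have \<psi>nn: "\<psi> (real q) \<ge> 0" for q :: nat using \<psi>0 by simp
  have \<psi>seq: "(\<lambda>q. \<psi> (real q)) \<longlonglongrightarrow> 0"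
    using filterlim_compose[OF \<psi>lim filterlim_real_sequentially] .
  have "\<forall>\<^sub>F q in sequentially. \<psi> (real q) < min (1 / C1) (h / 2)"
    using \<psi>seq C1 h by (intro order_tendstoD(2)[OF \<psi>seq]) auto
  then obtain N1 where N1: "\<And>q. q \<ge> N1 \<Longrightarrow> \<psi> (real q) < min (1 / C1) (h / 2)"
    unfolding eventually_sequentially by blast
  \<comment> \<open>Beyond \<open>N1\<close> the count applies with \<delta> = C1 \<psi>(q) \<le> 1
    and grid displacements are at most \<open>h\<close>; the 3 serves the logarithm.\<close>
  define N0 where "N0 = max N1 3"
  have big: "q \<ge> 3" "C1 * \<psi> (real q) \<le> 1" "2 * \<psi> (real q) / real q \<le> h" if "q \<ge> N0" for q
  proof -
    show q3: "q \<ge> 3" using that by (simp add: N0_def)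
    have "\<psi> (real q) < 1 / C1" "\<psi> (real q) < h / 2" using N1[of q] that by (auto simp: N0_def)
    then show "C1 * \<psi> (real q) \<le> 1" using C1 by (simp add: field_simps)
    have "2 * \<psi> (real q) / real q \<le> 2 * \<psi> (real q) / 1"
      using \<psi>nn[of q] q3 by (intro divide_left_mono) auto
    then show "2 * \<psi> (real q) / real q \<le> h" using \<open>\<psi> (real q) < h / 2\<close> by simp
  qed
  have cnt: "finite (I q) \<and> real (card (I q)) \<le> C * (real q ^ d * (C1 * \<psi> (real q)) ^ m)" if q: "q \<ge> N0" for q
  proof (cases "\<psi> (real q) = 0")
    case False
    then have pos: "\<psi> (real q) > 0" using \<psi>nn[of q] by linarith
    have "1 \<le> \<psi> (real q) ^ (2 * m + 1) * real q"
      unfolding m_def using big(1)[OF q] pos by (intro psi_power_ge \<psi>) auto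
    also have "\<dots> \<le> (C1 * \<psi> (real q)) ^ (2 * m + 1) * real q"
      using C1 pos by (intro mult_right_mono power_mono) auto
    finally show ?thesis
      using count[of q "C1 * \<psi> (real q)"] big[OF q] pos C1 False by (simp add: I_def)
  qed (use C \<psi>nn in \<open>simp add: I_def C1_def\<close>)
  have pair: "dist (x, f x) (y, f y) \<le> (1 + L) * norm (x - y)" if "x \<in> unit_cube" "y \<in> unit_cube" for x y
  proof -
    have "dist (x, f x) (y, f y) \<le> norm (x - y) + norm (f x - f y)"
      using norm_Pair_le[of "x - y" "f x - f y"] by (simp add: dist_norm)
    then show ?thesis using L(2)[OF that] by (simp add: distrib_right)
  qed
  have Gd: "dist u v \<le> R * (\<psi> (real q) / real q)" if "u \<in> G q a" "v \<in> G q a" for u v q a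
  proof -
    from that obtain x y where xy: "u = (x, f x)" "v = (y, f y)" "x \<in> unit_cube" "y \<in> unit_cube"
      "norm (x - grid_point q (\<mu> q) a) \<le> rad q" "norm (y - grid_point q (\<mu> q) a) \<le> rad q"
      unfolding G_def by blast
    have "norm (x - y) \<le> rad q + rad q"
      using norm_triangle_ineq4[of "x - grid_point q (\<mu> q) a" "y - grid_point q (\<mu> q) a"] xy(5,6) by simp
    then have "(1 + L) * norm (x - y) \<le> (1 + L) * (rad q + rad q)" using L by (intro mult_left_mono) auto
    then show ?thesis using pair[OF xy(3,4)] xy(1,2) by (simp add: rad_def R_def)
  qed
  have cover: "\<exists>q\<ge>N. u \<in> (\<Union>a\<in>I q. G q a)"
    if u: "u \<in> (\<lambda>x. (x, f x)) ` (unit_cube \<inter> W) \<inter> approximable \<psi> \<theta>" for u N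
  proof -
    from u obtain x where x: "u = (x, f x)" "x \<in> unit_cube" "x \<in> W" by blast
    have "infinite {q::nat. q \<ge> 1 \<and> dist_to_int_vec (real q *\<^sub>R u - \<theta>) < \<psi> (real q)}"
      using u by (simp add: approximable_def)
    then obtain q where q: "q \<ge> max N N0" "dist_to_int_vec (real q *\<^sub>R u - \<theta>) < \<psi> (real q)"
      unfolding infinite_nat_iff_unbounded_le by blast
    have q3: "q \<ge> 3" and qh: "2 * \<psi> (real q) / real q \<le> h" using big[of q] q by auto
    define a where "a i = round (real q * x $ i - fst \<theta> $ i)" for i
    define b where "b j = round (real q * f x $ j - snd \<theta> $ j)" for j
    have a: "\<bar>real q * x $ i - fst \<theta> $ i - a i\<bar> < \<psi> (real q)" for i
      using dist_to_int_vec_prod_less(1)[OF q(2), of i] by (simp add: a_def x(1))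
    have b: "\<bar>real q * f x $ j - snd \<theta> $ j - b j\<bar> < \<psi> (real q)" for j
      using dist_to_int_vec_prod_less(2)[OF q(2), of j] by (simp add: b_def x(1))
    have pos: "\<psi> (real q) > 0" using a by (meson abs_ge_zero le_less_trans)
    define z where "z = grid_point q (\<mu> q) a"
    have zi: "real q * (z $ i - x $ i) = \<sigma> i * \<psi> (real q) - (real q * x $ i - fst \<theta> $ i - a i)" for i
      using q3 by (simp add: z_def grid_point_def \<mu>_def field_simps)
    define t where "t = 2 * \<psi> (real q) / real q"
    have tq: "real q * t = 2 * \<psi> (real q)" using q3 by (simp add: t_def)
    have th: "t \<le> h" using qh by (simp add: t_def)
    \<comment> \<open>The shift by \<psi>(q) exceeds the rounding error, so it fixes the sign of the
      displacement and keeps it below 2 \<psi>(q) / q.\<close>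
    have side: "if p $ i \<le> 1 / 2 then 0 < z $ i - x $ i \<and> z $ i - x $ i < t
                else - t < z $ i - x $ i \<and> z $ i - x $ i < 0" for i
    proof -
      have q0: "real q > 0" using q3 by simp
      show ?thesis
      proof (cases "p $ i \<le> 1 / 2")
        case True
        then have "0 < real q * (z $ i - x $ i)" "real q * (z $ i - x $ i) < real q * t"
          using zi[of i] a[of i] unfolding tq \<sigma>_def by auto
        then show ?thesis using True q0 by (simp add: zero_less_mult_iff)
      next
        case False
        then have "real q * (z $ i - x $ i) < real q * 0" "real q * (- t) < real q * (z $ i - x $ i)"
          using zi[of i] a[of i] tq unfolding \<sigma>_def by auto
        then show ?thesis using False q0 by (simp only: mult_less_cancel_left_pos) simp
      qed
    qed
    have zV: "z \<in> V"
    proof -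
      have "max 0 (p $ i - r) \<le> z $ i \<and> z $ i \<le> min 1 (p $ i + r)" for i
      proof -
        have "0 \<le> x $ i" "x $ i \<le> 1" "p $ i - h < x $ i" "x $ i < p $ i + h"
          using x(2,3) by (auto simp: W_def mem_box_cart)
        then show ?thesis using side[of i] h th by (auto split: if_splits)
      qed
      then show ?thesis by (simp add: V_def mem_box_cart)
    qed
    have zU: "z \<in> unit_cube" using zV by (auto simp: V_def mem_box_cart)
    have nz: "norm (x - z) \<le> rad q"
    proof -
      have "\<bar>(x - z) $ i\<bar> \<le> t" for i using side[of i] by (auto split: if_splits)
      then have "norm (x - z) \<le> of_nat (card (UNIV :: 'd set)) * t"
        by (intro order_trans[OF norm_le_l1_cart] sum_bounded_above) auto
      then show ?thesis by (simp add: rad_def t_def d_def)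
    qed
    have "\<bar>real q * f z $ j - snd \<theta> $ j - b j\<bar> < C1 * \<psi> (real q)" for j
    proof -
      have "\<bar>f z $ j - f x $ j\<bar> \<le> norm (f x - f z)"
        using component_le_norm_cart[of "f x - f z" j] by (simp add: abs_minus_commute)
      also have "\<dots> \<le> L * rad q" using L(2)[OF x(2) zU] nz L(1) by (meson mult_left_mono less_imp_le order_trans)
      finally have "real q * \<bar>f z $ j - f x $ j\<bar> \<le> real q * (L * rad q)" by (intro mult_left_mono) auto
      also have "\<dots> = 2 * L * d * \<psi> (real q)" using q3 by (simp add: rad_def)
      finally have "\<bar>real q * f z $ j - real q * f x $ j\<bar> \<le> 2 * L * d * \<psi> (real q)"
        by (simp add: abs_mult flip: right_diff_distrib)
      then show ?thesis using b[of j] unfolding C1_def distrib_right by linarith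
    qed
    then have "a \<in> I q" using zV pos by (auto simp: I_def near_points_def z_def)
    moreover have "u \<in> G q a" using x nz by (auto simp: G_def z_def)
    ultimately show ?thesis using q(1) by auto
  qed
  define c where "c q = C * C1 ^ m * R powr s * ((\<psi> (real q) / real q) powr (s + real m) * real q ^ (m + d))" for q :: nat
  have "hausdorff_measure s ((\<lambda>x. (x, f x)) ` (unit_cube \<inter> W) \<inter> approximable \<psi> \<theta>) = 0"
  proof (rule hausdorff_measure_limsup_eq_0[OF cover, where ?r = "\<lambda>q. R * (\<psi> (real q) / real q)" and c = c and ?N0.0 = N0])
    show "finite (I q)" if "q \<ge> N0" for q using cnt[OF that] by blast
    show "bounded (G q a)" for q a using Gd[of _ q a] unfolding bounded_two_points by blast
    show "diameter (G q a) \<le> R * (\<psi> (real q) / real q)" for q a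
      using Gd[of _ q a] R \<psi>nn by (intro diameter_leI) auto
    show "(\<lambda>q. R * (\<psi> (real q) / real q)) \<longlonglongrightarrow> 0"
      using tendsto_mult[OF tendsto_const[of R] tendsto_mult[OF \<psi>seq lim_inverse_n]]
      by (simp add: divide_inverse)
    show "summable c" unfolding c_def m_def d_def by (intro summable_mult sum)
    show "s \<ge> 0" using s by simp
    show "real (card (I q)) * (R * (\<psi> (real q) / real q)) powr s \<le> c q" if q: "q \<ge> N0" for q
    proof (cases "\<psi> (real q) = 0")
      case True
      then show ?thesis by (simp add: I_def c_def)
    next
      case False
      define t where "t = \<psi> (real q) / real q"
      have q0: "real q > 0" using big(1)[OF q] by simp
      have t: "t > 0" "\<psi> (real q) = t * real q" using False \<psi>nn[of q] q0 by (auto simp: t_def)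
      have "real (card (I q)) * (R * t) powr s \<le> C * (real q ^ d * (C1 * \<psi> (real q)) ^ m) * (R * t) powr s"
        using cnt[OF q] by (intro mult_right_mono) auto
      \<comment> \<open>With \<psi>(q) = t q, the count contributes t^m q^(m+d) and the diameters
        contribute t^s.\<close>
      also have "\<dots> = C * C1 ^ m * R powr s * (t powr s * t ^ m * real q ^ (m + d))"
        using t R by (simp add: power_mult_distrib powr_mult power_add)
      also have "t powr s * t ^ m = t powr (s + real m)"
        using t by (simp add: powr_add powr_realpow)
      finally show ?thesis by (simp add: c_def t_def)
    qed
  qed
  then show ?thesis using W by blast
qed

section \<open>Countable cover of the graph away from the degenerate set\<close>

theorem theorem2:
  fixes f :: "real ^ 'd::{finite,linorder} \<Rightarrow> real ^ 'm::{finite,linorder}"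
    and \<theta> :: "(real ^ 'd::{finite,linorder}) \<times> (real ^ 'm::{finite,linorder})"
    and \<psi> :: "real \<Rightarrow> real"
    and s :: real
    and m d n :: nat
  assumes "m = CARD('m)" and "d = CARD('d)" and "m \<le> d" and "n = m + d"
    and "C2_partials_on unit_cube f"
    and "\<forall>r\<ge>0. \<psi> r \<ge> 0"
    and "(\<psi> \<longlongrightarrow> 0) at_top"
    and "\<forall>q::nat. q \<ge> 1 \<and> \<psi> (real q) > 0 \<longrightarrow>
           \<psi> (real q) \<ge>
             real q powr (- 1 / (2 * real m + 1)) * ln (real q) powr (2 / (2 * real m + 1))"
    and "0 < s" and "s \<le> real d"
    and "hausdorff_measure s {x \<in> unit_cube. det (mixed_hessian unit_cube f x) = 0} = 0"
    and "summable (\<lambda>k. (\<psi> (real (Suc k)) / real (Suc k)) powr (s + real m) * real (Suc k) ^ n)"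
  shows "hausdorff_measure s (graph_manifold unit_cube f \<inter> approximable \<psi> \<theta>) = 0"
proof -
  define g where "g x = (x, f x)" for x
  define Z where "Z = {x \<in> unit_cube. det (mixed_hessian unit_cube f x) = 0}"
  \<comment> \<open>The given series starts at q = 1; adding a term at q = 0 preserves
    summability.\<close>
  have sum: "summable (\<lambda>q. (\<psi> (real q) / real q) powr (s + real CARD('m)) * real q ^ (CARD('m) + CARD('d)))"
    using assms(12) unfolding assms(1,2,4) by (subst summable_Suc_iff[symmetric])
  have "\<exists>W. open W \<and> x \<in> W \<and> hausdorff_measure s (g ` (unit_cube \<inter> W) \<inter> approximable \<psi> \<theta>) = 0"
    if "x \<in> unit_cube - Z" for x
    unfolding g_def
  proof (rule local_graph_null)
    show "CARD('m) \<le> CARD('d)" using assms(1-3) by simp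
  qed (use assms sum that in \<open>auto simp: Z_def\<close>)
  then obtain W where W: "\<And>x. x \<in> unit_cube - Z \<Longrightarrow> open (W x)" "\<And>x. x \<in> unit_cube - Z \<Longrightarrow> x \<in> W x"
    "\<And>x. x \<in> unit_cube - Z \<Longrightarrow> hausdorff_measure s (g ` (unit_cube \<inter> W x) \<inter> approximable \<psi> \<theta>) = 0"
    by metis
  \<comment> \<open>The complement of \<open>Z\<close> in the cube may fail to be compact, so a
    countable subcover is taken.\<close>
  obtain F where F: "F \<subseteq> W ` (unit_cube - Z)" "countable F" "\<Union>F = \<Union>(W ` (unit_cube - Z))"
    using Lindelof[of "W ` (unit_cube - Z)"] W(1) by blast
  obtain L where L: "L > 0" "\<And>x y. x \<in> unit_cube \<Longrightarrow> y \<in> unit_cube \<Longrightarrow> norm (f x - f y) \<le> L * norm (x - y)"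
    using C2_lipschitz[OF assms(5)] by blast
  define \<U> where "\<U> = insert (g ` Z) ((\<lambda>V. g ` (unit_cube \<inter> V) \<inter> approximable \<psi> \<theta>) ` F)"
  have "hausdorff_measure s (\<Union>\<U>) = 0"
  proof (rule hausdorff_measure_countable_Union_eq_0)
    show "countable \<U>" using F(2) by (simp add: \<U>_def)
    \<comment> \<open>The hypothesis concerns parameters; the graph map is Lipschitz, hence carries
      the null set \<open>Z\<close> to a null set.\<close>
    have "hausdorff_measure s (g ` Z) = 0"
    proof (rule hausdorff_measure_lipschitz_image_eq_0[of s Z "1 + L"])
      show "hausdorff_measure s Z = 0" using assms(11) by (simp add: Z_def)
      fix x y assume "x \<in> Z" "y \<in> Z"
      then have "norm (f x - f y) \<le> L * norm (x - y)" using L(2) by (simp add: Z_def)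
      then show "dist (g x) (g y) \<le> (1 + L) * dist x y"
        using norm_Pair_le[of "x - y" "f x - f y"] by (simp add: dist_norm g_def distrib_right)
    qed (use assms L in auto)
    then show "hausdorff_measure s X = 0" if "X \<in> \<U>" for X
      using that F(1) W(3) by (auto simp: \<U>_def)
  qed
  moreover have "graph_manifold unit_cube f \<inter> approximable \<psi> \<theta> \<subseteq> \<Union>\<U>"
  proof
    fix u assume u: "u \<in> graph_manifold unit_cube f \<inter> approximable \<psi> \<theta>"
    then obtain x where x: "x \<in> unit_cube" "u = g x" by (auto simp: graph_manifold_def g_def)
    show "u \<in> \<Union>\<U>"
    proof (cases "x \<in> Z")
      case False
      then have "x \<in> \<Union>F" using F(3) W(2) x by blast
      then show ?thesis using x u by (auto simp: \<U>_def)
    qed (use x in \<open>auto simp: \<U>_def\<close>)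
  qed
  ultimately show ?thesis using hausdorff_measure_mono by (metis le_zero_eq)
qed

end
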